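(* Let $(\Omega,d,\mu)$ be a probability metric space satisfying the standing assumptions in the context, and let $J$ be an isoperimetric estimator of $(\Omega,d,\mu)$. Let $\bar X$ be a rearrangement invariant space on $(0,1)$, and suppose that $G:(0,1/2)\to(0,\infty)$ is a (measurable) function satisfying $$\int_0^{1/2}\frac{t}{J(t)}G(t)\,dt<\infty .$$ Then: 1. If $Q$ is bounded on $\bar X$, then for all $f\in Lip(\Omega)$, $$\int_0^{1/2}\left\|\left(f^{\ast}(\cdot)-f^{\ast}(t)\right)\chi_{[0,t)}(\cdot)\right\|_{\bar X}G(t)\,dt\le \|Q\|_{\bar X\to\bar X}\,\left\||\nabla f|^{\ast}\right\|_{\bar X}\int_0^{1/2}\frac{t}{J(t)}G(t)\,dt .$$ 2. If $P$ is bounded on $\bar X$, then for all $f\in Lip(\Omega)$, $$\int_0^{1/2}\left\|\left(f^{\ast\ast}(\cdot)-f^{\ast}(\cdot)\right)\chi_{[0,t)}(\cdot)\right\|_{\bar X}G(t)\,dt\le \|P\|_{\bar X\to\bar X}\,\left\||\nabla f|^{\ast}\right\|_{\bar X}\int_0^{1/2}\frac{t}{J(t)}G(t)\,dt .$$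
   Context: Standing assumptions. $(\Omega,d,\mu)$ is a connected metric space with a Borel probability measure $\mu$. For a Borel set $A\subset\Omega$, $P(A;\Omega)=\liminf_{h\to0^+}\frac{\mu(A_h)-\mu(A)}{h}$ with $A_h=\{x\in\Omega:d(x,A)<h\}$. The isoperimetric profile is $I(s)=\inf\{P(A;\Omega):\mu(A)=s\}$, $s\in[0,1]$. It is assumed that $I(0)=0$ and that $I$ is continuous, concave and symmetric about $1/2$. An isoperimetric estimator is a function $J:[0,1/2]\to[0,\infty)$ with the same properties (i.e. $J$ is the restriction to $[0,1/2]$ of a continuous concave function on $[0,1]$, symmetric about $1/2$ and vanishing at $0$) such that $I(t)\ge J(t)$ for $t\in(0,1/2)$. $Lip(\Omega)$ is the set of real-valued Lipschitz functions on $\Omega$, and $|\nabla f(x)|=\limsup_{d(x,y)\to0}\frac{|f(x)-f(y)|}{d(x,y)}$. Rearrangements. For measurable $u:\Omega\to\mathbb R$, $\mu_u(t)=\mu\{x:u(x)>t\}$, $t\in\mathbb R$, and $u^{\ast}(s)=u_\mu^\ast(s)=\inf\{t\in\mathbb R:\mu_u(t)\le s\}$, $s\in[0,1)$ (the right-continuous non-increasing function equimeasurable with $u$; it may take negative values, and the rearrangement of the absolute value is written $|u|^\ast$). $u^{\ast\ast}(t)=\frac1t\int_0^t u^\ast(s)\,ds$. $|\nabla f|^\ast$ is the rearrangement of the function $|\nabla f|$ with respect to $\mu$. A rearrangement invariant (r.i.) space $\bar X$ on $(0,1)$ is a Banach function space over $(0,1)$ with Lebesgue measure, with the Fatou property,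 such that if $g\in\bar X$ and $|f|^\ast=|g|^\ast$ then $f\in\bar X$ and $\|f\|_{\bar X}=\|g\|_{\bar X}$; one has $L^\infty\subset\bar X\subset L^1$ continuously. Hardy operators on functions on $(0,1)$: $Pg(t)=\frac1t\int_0^t g(s)\,ds$, $Qg(t)=\int_t^1 g(s)\frac{ds}{s}$. $\|\cdot\|_{\bar X\to\bar X}$ denotes the operator norm. *)

theory Defs
  imports "HOL-Probability.Probability"
begin

section \<open>Isoperimetry in a metric probability space\<close>

text \<open>
  The \<open>h\<close>-neighbourhood \<open>{x. d(x,A) < h}\<close>. It is not written with \<^const>\<open>infdist\<close>, because
  \<open>infdist x {} = 0\<close>, whereas the usual convention \<open>d(x,{}) = \<infinity>\<close> is needed here
  (the neighbourhood of the empty set is empty, so its perimeter is 0).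
\<close>

definition nbhd :: "'a::metric_space set \<Rightarrow> real \<Rightarrow> 'a set" where
  "nbhd A h = {x. \<exists>a\<in>A. dist x a < h}"

definition perimeter :: "'a::metric_space measure \<Rightarrow> 'a set \<Rightarrow> ereal" where
  "perimeter \<mu> A =
     Liminf (at_right 0) (\<lambda>h. ereal ((measure \<mu> (nbhd A h) - measure \<mu> A) / h))"

definition isop_profile :: "'a::metric_space measure \<Rightarrow> real \<Rightarrow> ereal" where
  "isop_profile \<mu> s = (INF A\<in>{A \<in> sets \<mu>. measure \<mu> A = s}. perimeter \<mu> A)"

definition profile_shape :: "(real \<Rightarrow> real) \<Rightarrow> bool" where
  "profile_shape \<phi> \<longleftrightarrow>
     \<phi> 0 = 0 \<and> continuous_on {0..1} \<phi> \<and> concave_on {0..1} \<phi> \<and>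
     (\<forall>s\<in>{0..1}. \<phi> (1 - s) = \<phi> s)"

text \<open>
  The metric space is the whole type \<open>'a\<close>. The profile is a priori extended real valued;
  being a continuous concave function on \<open>[0,1]\<close> vanishing at 0 includes being finite.
\<close>

definition isop_space :: "'a::metric_space measure \<Rightarrow> bool" where
  "isop_space \<mu> \<longleftrightarrow>
     connected (UNIV :: 'a set) \<and> sets \<mu> = sets borel \<and> prob_space \<mu> \<and>
     (\<exists>\<phi>. profile_shape \<phi> \<and> (\<forall>s\<in>{0..1}. isop_profile \<mu> s = ereal (\<phi> s)))"

definition isop_estimator :: "'a::metric_space measure \<Rightarrow> (real \<Rightarrow> real) \<Rightarrow> bool" where
  "isop_estimator \<mu> J \<longleftrightarrow>
     (\<forall>t\<in>{0..1/2}. 0 \<le> J t) \<and>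
     (\<exists>\<phi>. profile_shape \<phi> \<and> (\<forall>t\<in>{0..1/2}. J t = \<phi> t)) \<and>
     (\<forall>t\<in>{0<..<1/2}. ereal (J t) \<le> isop_profile \<mu> t)"

definition Lip :: "('a::metric_space \<Rightarrow> real) set" where
  "Lip = {f. \<exists>L. L-lipschitz_on UNIV f}"

text \<open>The modulus of the gradient; the upper limit is finite for Lipschitz functions.\<close>

definition grad_mod :: "('a::metric_space \<Rightarrow> real) \<Rightarrow> 'a \<Rightarrow> real" where
  "grad_mod f x = enn2real (Limsup (at x) (\<lambda>y. ennreal (\<bar>f x - f y\<bar> / dist x y)))"


section \<open>Rearrangements and Hardy operators\<close>

text \<open>
  The signed decreasing rearrangement. On a probability space and for measurable \<open>u\<close> the set is
  nonempty and bounded below whenever \<open>0 < s < 1\<close>. At \<open>s = 0\<close> the set is empty if \<open>u\<close> is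
  essentially unbounded above, and the value there is meaningless; the point 0 is never relevant
  below, since functions of \<open>s\<close> are considered almost everywhere on \<open>(0,1)\<close>.
\<close>

definition rearr :: "'a measure \<Rightarrow> ('a \<Rightarrow> real) \<Rightarrow> real \<Rightarrow> real" where
  "rearr M u s = Inf {t. measure M {x \<in> space M. u x > t} \<le> s}"

definition hardy_P :: "(real \<Rightarrow> real) \<Rightarrow> real \<Rightarrow> real" where
  "hardy_P g t = (1 / t) * (LINT s:{0<..<t}|lebesgue. g s)"

definition hardy_Q :: "(real \<Rightarrow> real) \<Rightarrow> real \<Rightarrow> real" where
  "hardy_Q g t = (LINT s:{t<..<1}|lebesgue. g s / s)"

definition rearr_avg :: "'a measure \<Rightarrow> ('a \<Rightarrow> real) \<Rightarrow> real \<Rightarrow> real" where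
  "rearr_avg M u = hardy_P (rearr M u)"


section \<open>Rearrangement invariant spaces on the unit interval\<close>

abbreviation leb01 :: "real measure" where
  "leb01 \<equiv> lebesgue_on {0<..<1}"

text \<open>
  A Banach function space is given, as in Bennett and Sharpley, by a function norm \<open>\<rho>\<close> on the
  nonnegative (extended real valued) measurable functions, monotone convergence being the Fatou
  property and the last two clauses giving the continuous embeddings of \<open>L\<^sup>\<infinity>\<close> into the space
  and of the space into \<open>L\<^sup>1\<close>. Completeness is a consequence of these axioms. Only the values
  of \<open>\<rho>\<close> on measurable functions matter.
\<close>

definition banach_function_norm :: "((real \<Rightarrow> ennreal) \<Rightarrow> ennreal) \<Rightarrow> bool" where
  "banach_function_norm \<rho> \<longleftrightarrow>
     (\<forall>F\<in>borel_measurable leb01. \<rho> F = 0 \<longleftrightarrow> (AE x in leb01. F x = 0)) \<and>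
     (\<forall>F\<in>borel_measurable leb01. \<forall>a\<ge>0. \<rho> (\<lambda>x. ennreal a * F x) = ennreal a * \<rho> F) \<and>
     (\<forall>F\<in>borel_measurable leb01. \<forall>H\<in>borel_measurable leb01.
        \<rho> (\<lambda>x. F x + H x) \<le> \<rho> F + \<rho> H) \<and>
     (\<forall>F\<in>borel_measurable leb01. \<forall>H\<in>borel_measurable leb01.
        (AE x in leb01. F x \<le> H x) \<longrightarrow> \<rho> F \<le> \<rho> H) \<and>
     (\<forall>Fn. \<forall>F\<in>borel_measurable leb01.
        (\<forall>n::nat. Fn n \<in> borel_measurable leb01) \<longrightarrow>
        (AE x in leb01. incseq (\<lambda>n. Fn n x) \<and> F x = (SUP n. Fn n x)) \<longrightarrow>
        \<rho> F = (SUP n. \<rho> (Fn n))) \<and>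
     (\<forall>E\<in>sets leb01. \<rho> (indicator E) < \<infinity>) \<and>
     (\<forall>E\<in>sets leb01. \<exists>C::real. \<forall>F\<in>borel_measurable leb01.
        (\<integral>\<^sup>+x\<in>E. F x \<partial>leb01) \<le> ennreal C * \<rho> F)"

text \<open>The norm of a real valued measurable function, equal to \<open>\<infinity>\<close> off the space.\<close>

definition bfs_norm :: "((real \<Rightarrow> ennreal) \<Rightarrow> ennreal) \<Rightarrow> (real \<Rightarrow> real) \<Rightarrow> ennreal" where
  "bfs_norm \<rho> f = \<rho> (\<lambda>x. ennreal \<bar>f x\<bar>)"

definition bfs_space :: "((real \<Rightarrow> ennreal) \<Rightarrow> ennreal) \<Rightarrow> (real \<Rightarrow> real) set" where
  "bfs_space \<rho> = {f \<in> borel_measurable leb01. bfs_norm \<rho> f < \<infinity>}"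

definition ri_norm :: "((real \<Rightarrow> ennreal) \<Rightarrow> ennreal) \<Rightarrow> bool" where
  "ri_norm \<rho> \<longleftrightarrow>
     banach_function_norm \<rho> \<and>
     (\<forall>f\<in>borel_measurable leb01. \<forall>g\<in>bfs_space \<rho>.
        (\<forall>s\<in>{0<..<1}. rearr leb01 (\<lambda>x. \<bar>f x\<bar>) s = rearr leb01 (\<lambda>x. \<bar>g x\<bar>) s) \<longrightarrow>
        f \<in> bfs_space \<rho> \<and> bfs_norm \<rho> f = bfs_norm \<rho> g)"

definition bounded_on ::
  "((real \<Rightarrow> ennreal) \<Rightarrow> ennreal) \<Rightarrow> ((real \<Rightarrow> real) \<Rightarrow> real \<Rightarrow> real) \<Rightarrow> bool" where
  "bounded_on \<rho> T \<longleftrightarrow>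
     (\<exists>C::real. \<forall>f\<in>bfs_space \<rho>.
        T f \<in> bfs_space \<rho> \<and> bfs_norm \<rho> (T f) \<le> ennreal C * bfs_norm \<rho> f)"

definition op_norm ::
  "((real \<Rightarrow> ennreal) \<Rightarrow> ennreal) \<Rightarrow> ((real \<Rightarrow> real) \<Rightarrow> real \<Rightarrow> real) \<Rightarrow> ennreal" where
  "op_norm \<rho> T = (SUP f\<in>{f \<in> bfs_space \<rho>. bfs_norm \<rho> f \<le> 1}. bfs_norm \<rho> (T f))"

text \<open>
  The integral of \<open>t G(t) / J(t)\<close> over \<open>(0,1/2)\<close>. The quotient is taken in \<^typ>\<open>ennreal\<close>,
  where \<open>t / 0 = \<infinity>\<close> for \<open>t > 0\<close>; with real division a degenerate \<open>J\<close> would make it 0.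
\<close>

definition weight_integral :: "(real \<Rightarrow> real) \<Rightarrow> (real \<Rightarrow> real) \<Rightarrow> ennreal" where
  "weight_integral J G =
     (\<integral>\<^sup>+t. ennreal t / ennreal (J t) * ennreal (G t) \<partial>lebesgue_on {0<..<1/2})"

end

theory Submission
  imports Defs
begin

text \<open>
  The Bobkov--Houdre form of the coarea inequality bounds the integral of the perimeters of \<open>{f > y}\<close> over
  an open set of levels \<open>y\<close> by the integral of \<open>|\<nabla>f|\<close> over the corresponding part of the space. These
  perimeters are at least \<open>J(\<mu>\<^sub>f(y))\<close> and \<open>s / J(s)\<close> is increasing, so
  \<open>f\<^sup>*\<^sup>* - f\<^sup>* \<le> (s / J(s)) P(|\<nabla>f|\<^sup>*)\<close> with the Hardy operator \<open>P\<close>, whence the second inequality.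

  For the first one, no majorization theorem is needed. For \<open>\<theta> > 1\<close> slice the space by the levels
  \<open>a\<^sub>i = f\<^sup>*(t / \<theta>\<^sup>i)\<close> and rearrange \<open>|\<nabla>f|\<close> slice by slice, increasingly within each slice, to a
  function \<open>h\<close> on \<open>(0,1)\<close>. Then \<open>h\<close> is equimeasurable with \<open>|\<nabla>f|\<close>, so both have the same norm, while
  \<open>f\<^sup>*(s) - f\<^sup>*(t) \<le> \<theta> (t / J(t)) Q h (s)\<close> for \<open>t / \<theta>\<^sup>n \<le> s < t\<close>. Let \<open>n \<rightarrow> \<infinity>\<close>, using the Fatou property,
  and then \<open>\<theta> \<rightarrow> 1\<close>.
\<close>

subsection \<open>Distribution of the rearrangement\<close>

lemma prob_space_leb01: "prob_space leb01"
  by (rule prob_spaceI) (simp add: emeasure_restrict_space)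

lemma measure_leb01:
  assumes "A \<in> sets lebesgue" "A \<subseteq> {0<..<1}"
  shows "measure leb01 A = measure lebesgue A"
  using assms by (simp add: measure_restrict_space)

text \<open>The condition under the infimum says that the distribution function of \<open>u\<close>
  is at least \<open>1 - s\<close>, so \<open>rearr M u s\<close> is a quantile. Right continuity
  makes the infimum attained, which gives a Galois connection for \<open>s\<close> strictly between
  0 and 1.\<close>

lemma rearr_le_iff:
  assumes M: "prob_space M" and u: "u \<in> borel_measurable M" and s: "0 < s" "s < 1"
  shows "rearr M u s \<le> y \<longleftrightarrow> measure M {x \<in> space M. u x > y} \<le> s"
proof -
  interpret prob_space M by fact
  interpret D: real_distribution "distr M borel u"
    using real_distribution_distr u by blast
  interpret C: cdf_distribution "distr M borel u"
    by unfold_locales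
  have *: "measure M {x \<in> space M. u x > z} \<le> s \<longleftrightarrow> 1 - s \<le> cdf (distr M borel u) z" for z
  proof -
    have "cdf (distr M borel u) z = measure M {x \<in> space M. u x \<le> z}"
      using u by (auto simp: cdf_def measure_distr intro!: arg_cong[where f="measure M"])
    moreover have "measure M {x \<in> space M. u x \<le> z} = 1 - measure M {x \<in> space M. \<not> u x \<le> z}"
      using u by (subst prob_neg) auto
    ultimately show ?thesis by (auto simp: not_le)
  qed
  have "1 - s \<le> cdf (distr M borel u) y \<longleftrightarrow> Inf {x. 1 - s \<le> cdf (distr M borel u) x} \<le> y"
    using s by (intro C.pseudoinverse) auto
  then show ?thesis
    by (simp add: * rearr_def)
qed

lemma less_rearr_iff:
  assumes "prob_space M" "u \<in> borel_measurable M" "0 < s" "s < 1"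
  shows "y < rearr M u s \<longleftrightarrow> s < measure M {x \<in> space M. y < u x}"
  using rearr_le_iff[OF assms, of y] by linarith

lemma rearr_antimono:
  assumes "prob_space M" "u \<in> borel_measurable M" "0 < s" "s \<le> t" "t < 1"
  shows "rearr M u t \<le> rearr M u s"
  using rearr_le_iff[of M u t "rearr M u s"] rearr_le_iff[of M u s "rearr M u s"] assms by linarith

lemma rearr_superlevel:
  assumes "prob_space M" "u \<in> borel_measurable M"
  shows "{s \<in> space leb01. y < rearr M u s} = {0<..<measure M {x \<in> space M. y < u x}}"
proof -
  interpret prob_space M by fact
  show ?thesis
    using less_rearr_iff[OF assms] prob_le_1[of "{x \<in> space M. y < u x}"]
    by (auto simp: less_le_trans)
qed

lemma borel_measurable_rearr:
  assumes "prob_space M" "u \<in> borel_measurable M"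
  shows "rearr M u \<in> borel_measurable leb01"
proof (subst borel_measurable_iff_greater, intro allI)
  interpret prob_space M by fact
  fix y
  show "{s \<in> space leb01. y < rearr M u s} \<in> sets leb01"
    unfolding rearr_superlevel[OF assms]
    by (subst sets_restrict_space_iff) (auto simp: less_le_trans[OF _ prob_le_1])
qed

text \<open>The distribution functions agree because superlevel sets have equal measure. Stated for
  laws, this transfers integrals of, and compositions with, arbitrary Borel functions.\<close>

lemma distr_rearr:
  assumes M: "prob_space M" and u: "u \<in> borel_measurable M"
  shows "distr leb01 borel (rearr M u) = distr M borel u"
proof (intro cdf_unique ext)
  interpret prob_space M by fact
  interpret L: prob_space leb01 by (rule prob_space_leb01)
  have r[measurable]: "rearr M u \<in> borel_measurable leb01"
    by (rule borel_measurable_rearr[OF assms])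
  note u[measurable]
  show "real_distribution (distr leb01 borel (rearr M u))"
    using L.real_distribution_distr r by blast
  show "real_distribution (distr M borel u)"
    using real_distribution_distr u by blast
  fix y
  let ?m = "measure M {x \<in> space M. y < u x}"
  have "cdf (distr leb01 borel (rearr M u)) y = measure leb01 {s \<in> space leb01. \<not> y < rearr M u s}"
    using r by (auto simp: cdf_def measure_distr not_less intro!: arg_cong[where f="measure leb01"])
  also have "\<dots> = 1 - measure leb01 {s \<in> space leb01. y < rearr M u s}"
    by (intro L.prob_neg) measurable
  also have "\<dots> = 1 - ?m"
    unfolding rearr_superlevel[OF assms]
    by (subst measure_leb01) (auto simp: less_le_trans[OF _ prob_le_1])
  also have "\<dots> = measure M {x \<in> space M. \<not> y < u x}"
    by (intro prob_neg[symmetric]) measurable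
  also have "\<dots> = cdf (distr M borel u) y"
    using u by (auto simp: cdf_def measure_distr not_less intro!: arg_cong[where f="measure M"])
  finally show "cdf (distr leb01 borel (rearr M u)) y = cdf (distr M borel u) y" .
qed

lemma nn_integral_rearr:
  assumes "prob_space M" "u \<in> borel_measurable M" "F \<in> borel_measurable borel"
  shows "(\<integral>\<^sup>+s. F (rearr M u s) \<partial>leb01) = (\<integral>\<^sup>+x. F (u x) \<partial>M)"
proof -
  have "(\<integral>\<^sup>+s. F (rearr M u s) \<partial>leb01) = (\<integral>\<^sup>+y. F y \<partial>distr leb01 borel (rearr M u))"
    using assms borel_measurable_rearr by (subst nn_integral_distr) auto
  also have "\<dots> = (\<integral>\<^sup>+x. F (u x) \<partial>M)"
    unfolding distr_rearr[OF assms(1,2)] using assms by (subst nn_integral_distr) auto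
  finally show ?thesis .
qed

text \<open>A rearrangement depends only on the law of the function. This identifies the
  rearrangement of the function built in \<open>layered_rearrangement\<close> and deals with the
  absolute values in the invariance axiom.\<close>

lemma rearr_comp_rearr:
  assumes M: "prob_space M" and u: "u \<in> borel_measurable M" and g: "g \<in> borel_measurable borel"
  shows "rearr leb01 (\<lambda>s. g (rearr M u s)) = rearr M (\<lambda>x. g (u x))"
proof -
  note r = borel_measurable_rearr[OF M u]
  have "measure leb01 {s \<in> space leb01. y < g (rearr M u s)} = measure M {x \<in> space M. y < g (u x)}" for y
  proof -
    have S: "{z. y < g z} \<in> sets borel" using g by measurable
    have "measure leb01 {s \<in> space leb01. y < g (rearr M u s)}
        = measure (distr leb01 borel (rearr M u)) {z. y < g z}"
      using r S by (auto simp: measure_distr intro!: arg_cong[where f="measure leb01"])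
    also have "\<dots> = measure M {x \<in> space M. y < g (u x)}"
      unfolding distr_rearr[OF M u]
      using u S by (auto simp: measure_distr intro!: arg_cong[where f="measure M"])
    finally show ?thesis .
  qed
  then show ?thesis
    by (intro ext) (simp add: rearr_def)
qed

text \<open>Pointwise \<open>u * 1_E \<le> (u - c) * 1_A + c * 1_E\<close> with truncated
  subtraction; for \<open>v\<close> and \<open>D\<close> equality holds, since \<open>v\<close> is
  at least \<open>c\<close> on \<open>D\<close> and at most \<open>c\<close> on the rest of
  \<open>B\<close>. So a set on which \<open>v\<close> takes its largest values beats every set of
  no larger measure. The excesses over \<open>c\<close> have equal integrals by equimeasurability in
  the applications.\<close>

lemma bathtub:
  fixes u :: "'a \<Rightarrow> ennreal" and v :: "'b \<Rightarrow> ennreal"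
  assumes [measurable]: "u \<in> borel_measurable M" "v \<in> borel_measurable N"
    and [measurable]: "E \<in> sets M" "A \<in> sets M" "D \<in> sets N" "B \<in> sets N"
    and sub: "E \<subseteq> A" "D \<subseteq> B"
    and eq: "(\<integral>\<^sup>+x\<in>A. (u x - c) \<partial>M) = (\<integral>\<^sup>+x\<in>B. (v x - c) \<partial>N)"
    and le: "emeasure M E \<le> emeasure N D"
    and D: "\<And>x. x \<in> D \<Longrightarrow> c \<le> v x" "\<And>x. x \<in> B - D \<Longrightarrow> v x \<le> c"
    and c: "c < \<infinity>"
  shows "(\<integral>\<^sup>+x\<in>E. u x \<partial>M) \<le> (\<integral>\<^sup>+x\<in>D. v x \<partial>N)"
proof -
  have "(\<integral>\<^sup>+x\<in>E. u x \<partial>M) \<le> (\<integral>\<^sup>+x. ((u x - c) * indicator A x + c * indicator E x) \<partial>M)"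
  proof (intro nn_integral_mono)
    fix x
    have "u x \<le> (u x - c) + c"
      by (cases "c \<le> u x") (auto simp: diff_add_cancel_ennreal add_increasing)
    then show "u x * indicator E x \<le> (u x - c) * indicator A x + c * indicator E x"
      using sub by (auto split: split_indicator)
  qed
  also have "\<dots> = (\<integral>\<^sup>+x\<in>A. (u x - c) \<partial>M) + c * emeasure M E"
    by (subst nn_integral_add) (auto simp: nn_integral_cmult_indicator)
  also have "\<dots> \<le> (\<integral>\<^sup>+x\<in>B. (v x - c) \<partial>N) + c * emeasure N D"
    using le by (auto simp: eq intro!: add_left_mono mult_left_mono)
  also have "\<dots> = (\<integral>\<^sup>+x. ((v x - c) * indicator B x + c * indicator D x) \<partial>N)"
    by (subst nn_integral_add) (auto simp: nn_integral_cmult_indicator)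
  also have "\<dots> = (\<integral>\<^sup>+x\<in>D. v x \<partial>N)"
  proof (intro nn_integral_cong)
    fix x
    show "(v x - c) * indicator B x + c * indicator D x = v x * indicator D x"
      using D(1)[of x] D(2)[of x] sub c
      by (cases "x \<in> D"; cases "x \<in> B") (auto simp: diff_add_cancel_ennreal diff_eq_0_iff_ennreal le_less_trans)
  qed
  finally show ?thesis .
qed

subsection \<open>The coarea inequality\<close>

lemma nbhd_eq_Union_ball: "nbhd A h = (\<Union>a\<in>A. ball a h)"
  by (auto simp: nbhd_def dist_commute)

lemma open_nbhd: "open (nbhd A h)"
  by (auto simp: nbhd_eq_Union_ball)

lemma subset_nbhd: "0 < h \<Longrightarrow> A \<subseteq> nbhd A h"
  by (force simp: nbhd_def)

text \<open>Its superlevel sets are the \<open>h\<close>-neighbourhoods of those of \<open>f\<close>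
  (\<open>less_sup_ball_iff\<close>). Hence \<open>f x \<le> y < sup_ball f h x\<close> describes
  the ring between \<open>{f > y}\<close> and its neighbourhood.\<close>

definition sup_ball :: "('a::metric_space \<Rightarrow> real) \<Rightarrow> real \<Rightarrow> 'a \<Rightarrow> real" where
  "sup_ball f h x = (SUP y\<in>ball x h. f y)"

definition slope_sup :: "('a::metric_space \<Rightarrow> real) \<Rightarrow> real \<Rightarrow> 'a \<Rightarrow> ennreal" where
  "slope_sup f r x = (SUP y\<in>ball x r - {x}. ennreal (\<bar>f x - f y\<bar> / dist x y))"

lemma LipE:
  assumes "f \<in> Lip"
  obtains L where "0 \<le> L" "\<And>x y. \<bar>f x - f y\<bar> \<le> L * dist x y"
  using assms by (auto simp: Lip_def lipschitz_on_def dist_real_def)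

lemma continuous_on_Lip: "f \<in> Lip \<Longrightarrow> continuous_on UNIV f"
  by (auto simp: Lip_def intro: lipschitz_on_continuous_on)

lemma borel_measurable_Lip: "f \<in> Lip \<Longrightarrow> f \<in> borel_measurable borel"
  by (simp add: borel_measurable_continuous_onI continuous_on_Lip)

lemma bdd_above_Lip_ball: "f \<in> Lip \<Longrightarrow> bdd_above (f ` ball x h)"
proof (erule LipE)
  fix L assume L: "0 \<le> L" "\<And>x y. \<bar>f x - f y\<bar> \<le> L * dist x y"
  show ?thesis
  proof (rule bdd_aboveI2)
    fix y assume "y \<in> ball x h"
    then have "L * dist y x \<le> L * h"
      using L(1) by (intro mult_left_mono) (auto simp: dist_commute)
    then show "f y \<le> f x + L * h" using L(2)[of y x] by linarith
  qed
qed

lemma less_sup_ball_iff: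
  assumes "f \<in> Lip" "0 < h"
  shows "c < sup_ball f h x \<longleftrightarrow> x \<in> nbhd {y. c < f y} h"
  unfolding sup_ball_def using assms bdd_above_Lip_ball[of f x h]
  by (subst less_cSUP_iff) (auto simp: nbhd_def)

lemma borel_measurable_sup_ball:
  assumes "f \<in> Lip" "0 < h"
  shows "sup_ball f h \<in> borel_measurable borel"
  by (subst borel_measurable_iff_greater) (simp add: less_sup_ball_iff[OF assms] open_nbhd)

lemma le_sup_ball: "f \<in> Lip \<Longrightarrow> 0 < h \<Longrightarrow> f x \<le> sup_ball f h x"
  unfolding sup_ball_def by (intro cSUP_upper bdd_above_Lip_ball) auto

lemma slope_sup_mono: "r \<le> r' \<Longrightarrow> slope_sup f r x \<le> slope_sup f r' x"
  unfolding slope_sup_def by (intro SUP_subset_mono) auto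

lemma slope_sup_le_Lip:
  assumes "0 \<le> L" "\<And>x y. \<bar>f x - f y\<bar> \<le> L * dist x y"
  shows "slope_sup f r x \<le> ennreal L"
  unfolding slope_sup_def
proof (intro SUP_least ennreal_leI)
  fix y assume "y \<in> ball x r - {x}"
  then show "\<bar>f x - f y\<bar> / dist x y \<le> L"
    using assms(2)[of x y] by (auto simp: divide_le_eq)
qed

text \<open>Lower semicontinuity: for fixed \<open>y\<close> the difference quotient is continuous
  in \<open>x\<close> on the punctured ball around \<open>y\<close>, so a superlevel set is a
  (possibly uncountable) union of open sets.\<close>

lemma borel_measurable_slope_sup:
  assumes "f \<in> Lip"
  shows "slope_sup f r \<in> borel_measurable borel"
proof (rule borel_measurableI_greater)
  fix c
  have "{x \<in> space borel. c < slope_sup f r x}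
      = (\<Union>y. {x. c < ennreal (\<bar>f x - f y\<bar> / dist x y)} \<inter> (ball y r - {y}))"
    by (auto simp: slope_sup_def less_SUP_iff dist_commute)
  also have "open \<dots>"
  proof (intro open_UN ballI)
    fix y
    have "continuous_on (ball y r - {y}) (\<lambda>x. ennreal (\<bar>f x - f y\<bar> / dist x y))"
      by (intro continuous_intros continuous_on_ennreal continuous_on_subset[OF continuous_on_Lip[OF assms]]) auto
    then have "open ((\<lambda>x. ennreal (\<bar>f x - f y\<bar> / dist x y)) -` {c<..} \<inter> (ball y r - {y}))"
      by (subst (asm) continuous_on_open_vimage) (auto simp: open_delete)
    then show "open ({x. c < ennreal (\<bar>f x - f y\<bar> / dist x y)} \<inter> (ball y r - {y}))"
      by (simp add: vimage_def)
  qed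
  finally show "{x \<in> space borel. c < slope_sup f r x} \<in> sets borel" by simp
qed

text \<open>Monotonicity in the radius reduces the infimum over all radii to a sequence, which
  yields measurability of the gradient. A Lipschitz constant bounds the infimum, so
  \<open>enn2real\<close> loses nothing.\<close>

lemma ennreal_grad_mod:
  assumes "f \<in> Lip"
  shows "ennreal (grad_mod f x) = (INF n. slope_sup f (1 / real (Suc n)) x)"
proof -
  obtain L where L: "0 \<le> L" "\<And>x y. \<bar>f x - f y\<bar> \<le> L * dist x y"
    using LipE[OF assms] by blast
  have eq: "Limsup (at x) (\<lambda>y. ennreal (\<bar>f x - f y\<bar> / dist x y)) = (INF r\<in>{0<..}. slope_sup f r x)"
    by (simp add: Limsup_within slope_sup_def)
  also have "\<dots> = (INF n. slope_sup f (1 / real (Suc n)) x)"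
  proof (rule INF_eq)
    fix r :: real assume "r \<in> {0<..}"
    then obtain n where "1 / real (Suc n) < r"
      using reals_Archimedean[of r] by (auto simp: inverse_eq_divide)
    then show "\<exists>n\<in>UNIV. slope_sup f (1 / real (Suc n)) x \<le> slope_sup f r x"
      using slope_sup_mono[of "1 / real (Suc n)" r f x] by auto
  qed (auto intro!: bexI[of _ "1 / real (Suc _)"])
  finally have *: "Limsup (at x) (\<lambda>y. ennreal (\<bar>f x - f y\<bar> / dist x y))
      = (INF n. slope_sup f (1 / real (Suc n)) x)" .
  have "(INF n. slope_sup f (1 / real (Suc n)) x) \<le> ennreal L"
    by (rule INF_lower2[where i=0]) (auto intro: slope_sup_le_Lip[OF L])
  then have "(INF n. slope_sup f (1 / real (Suc n)) x) < \<top>"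
    using ennreal_less_top le_less_trans by blast
  then show ?thesis
    by (simp add: grad_mod_def *)
qed

lemma grad_mod_nonneg: "0 \<le> grad_mod f x"
  by (simp add: grad_mod_def)

lemma grad_mod_le_Lip:
  assumes "f \<in> Lip" "0 \<le> L" "\<And>x y. \<bar>f x - f y\<bar> \<le> L * dist x y"
  shows "grad_mod f x \<le> L"
proof -
  have "ennreal (grad_mod f x) \<le> ennreal L"
    unfolding ennreal_grad_mod[OF assms(1)]
    by (rule INF_lower2[where i=0]) (auto intro: slope_sup_le_Lip[OF assms(2,3)])
  then show ?thesis using assms(2) by simp
qed

lemma borel_measurable_grad_mod:
  assumes "f \<in> Lip"
  shows "grad_mod f \<in> borel_measurable borel"
proof -
  have "(\<lambda>x. INF n. slope_sup f (1 / real (Suc n)) x) \<in> borel_measurable borel"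
    by (intro borel_measurable_INF borel_measurable_slope_sup[OF assms]) auto
  then have "(\<lambda>x. enn2real (INF n. slope_sup f (1 / real (Suc n)) x)) \<in> borel_measurable borel"
    by measurable
  then show ?thesis
    unfolding ennreal_grad_mod[OF assms, symmetric] by (simp add: grad_mod_nonneg)
qed

lemma sup_ball_diff_le_slope_sup:
  assumes f: "f \<in> Lip" and h: "0 < h"
  shows "ennreal ((sup_ball f h x - f x) / h) \<le> slope_sup f h x"
proof (cases "slope_sup f h x")
  case (real w)
  have "sup_ball f h x \<le> f x + h * w"
    unfolding sup_ball_def
  proof (rule cSUP_least)
    fix y assume y: "y \<in> ball x h"
    show "f y \<le> f x + h * w"
    proof (cases "y = x")
      case False
      then have "ennreal (\<bar>f x - f y\<bar> / dist x y) \<le> ennreal w"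
        unfolding real(2)[symmetric] slope_sup_def using y by (intro SUP_upper) auto
      then have "\<bar>f x - f y\<bar> / dist x y \<le> w"
        using real(1) by simp
      then have "\<bar>f x - f y\<bar> \<le> w * dist x y"
        using False by (simp add: divide_le_eq)
      also have "\<dots> \<le> w * h" using y real(1) by (intro mult_left_mono) auto
      finally show ?thesis by (simp add: mult.commute)
    qed (use real h in auto)
  qed (use h in auto)
  then show ?thesis
    unfolding real(2) using h by (intro ennreal_leI) (simp add: field_simps)
qed simp

section \<open>Measure of the region between two graphs\<close>

lemma sets_between_graphs:
  fixes p r :: "'a \<Rightarrow> real"
  assumes [measurable]: "p \<in> borel_measurable M" "r \<in> borel_measurable M" "B \<in> sets borel"
  shows "{z \<in> space (M \<Otimes>\<^sub>M lborel). snd z \<in> B \<and> p (fst z) \<le> snd z \<and> snd z < r (fst z)} \<in> sets (M \<Otimes>\<^sub>M lborel)"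
proof -
  have "sets (M \<Otimes>\<^sub>M lborel) = sets (M \<Otimes>\<^sub>M borel)"
    by (rule sets_pair_measure_cong) simp_all
  moreover have "{z \<in> space (M \<Otimes>\<^sub>M borel). snd z \<in> B \<and> p (fst z) \<le> snd z \<and> snd z < r (fst z)} \<in> sets (M \<Otimes>\<^sub>M borel)"
    by measurable
  ultimately show ?thesis by (simp add: space_pair_measure)
qed

lemma borel_measurable_emeasure_Int_Ico:
  fixes p r :: "'a \<Rightarrow> real"
  assumes [measurable]: "p \<in> borel_measurable M" "r \<in> borel_measurable M" "B \<in> sets borel"
  shows "(\<lambda>x. emeasure lborel (B \<inter> {p x..<r x})) \<in> borel_measurable M"
proof -
  let ?S = "{z \<in> space (M \<Otimes>\<^sub>M lborel). snd z \<in> B \<and> p (fst z) \<le> snd z \<and> snd z < r (fst z)}"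
  have "(\<lambda>x. emeasure lborel (Pair x -` ?S)) \<in> borel_measurable M"
    by (intro lborel.measurable_emeasure_Pair sets_between_graphs assms)
  moreover have "emeasure lborel (Pair x -` ?S) = emeasure lborel (B \<inter> {p x..<r x})" if "x \<in> space M" for x
    using that by (intro arg_cong[where f="emeasure lborel"]) (auto simp: space_pair_measure)
  ultimately show ?thesis
    using measurable_cong by (metis (no_types, lifting))
qed

text \<open>Tonelli for the region \<open>p x \<le> y < r x\<close> over levels in \<open>B\<close>.
  With half-open intervals the section at level \<open>y\<close> is \<open>{y < r}\<close> minus
  \<open>{y < p}\<close>, a difference of strict superlevel sets.\<close>

lemma layer_cake:
  fixes p r :: "'a \<Rightarrow> real"
  assumes M: "prob_space M"
    and [measurable]: "p \<in> borel_measurable M" "r \<in> borel_measurable M" "B \<in> sets borel"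
  shows "(\<integral>\<^sup>+x. emeasure lborel (B \<inter> {p x..<r x}) \<partial>M)
       = (\<integral>\<^sup>+y\<in>B. emeasure M {x \<in> space M. p x \<le> y \<and> y < r x} \<partial>lborel)"
proof -
  interpret prob_space M by fact
  interpret P: pair_sigma_finite M lborel ..
  let ?S = "\<lambda>x y. indicator {z \<in> space (M \<Otimes>\<^sub>M lborel). snd z \<in> B \<and> p (fst z) \<le> snd z \<and> snd z < r (fst z)} (x, y) :: ennreal"
  have "(\<integral>\<^sup>+x. emeasure lborel (B \<inter> {p x..<r x}) \<partial>M) = (\<integral>\<^sup>+x. \<integral>\<^sup>+y. ?S x y \<partial>lborel \<partial>M)"
  proof (intro nn_integral_cong)
    fix x assume "x \<in> space M"
    then have "(\<integral>\<^sup>+y. ?S x y \<partial>lborel) = (\<integral>\<^sup>+y. indicator (B \<inter> {p x..<r x}) y \<partial>lborel)"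
      by (intro nn_integral_cong) (auto split: split_indicator simp: space_pair_measure)
    then show "emeasure lborel (B \<inter> {p x..<r x}) = (\<integral>\<^sup>+y. ?S x y \<partial>lborel)"
      by (subst nn_integral_indicator[symmetric]) auto
  qed
  also have "\<dots> = (\<integral>\<^sup>+y. \<integral>\<^sup>+x. ?S x y \<partial>M \<partial>lborel)"
    by (intro P.Fubini'[symmetric]) (simp add: borel_measurable_indicator sets_between_graphs[OF assms(2-)])
  also have "\<dots> = (\<integral>\<^sup>+y\<in>B. emeasure M {x \<in> space M. p x \<le> y \<and> y < r x} \<partial>lborel)"
  proof (intro nn_integral_cong)
    fix y
    have "(\<integral>\<^sup>+x. ?S x y \<partial>M) = (\<integral>\<^sup>+x. indicator B y * indicator {x \<in> space M. p x \<le> y \<and> y < r x} x \<partial>M)"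
      by (intro nn_integral_cong) (auto split: split_indicator simp: space_pair_measure)
    also have "\<dots> = indicator B y * emeasure M {x \<in> space M. p x \<le> y \<and> y < r x}"
      by (subst nn_integral_cmult_indicator) auto
    finally show "(\<integral>\<^sup>+x. ?S x y \<partial>M) = emeasure M {x \<in> space M. p x \<le> y \<and> y < r x} * indicator B y"
      by (simp add: mult.commute)
  qed
  finally show ?thesis .
qed

text \<open>Fatou over the levels bounds the perimeters by difference quotients, Tonelli moves these
  to the space, and reverse Fatou leads to the gradient. If \<open>f x\<close> is outside the closed
  set \<open>K\<close>, it has positive distance from \<open>K\<close>, and the short interval from
  \<open>f x\<close> to \<open>sup_ball f (h n) x\<close> eventually misses
  \<open>K\<close>.\<close>

lemma coarea_closed:
  fixes \<mu> :: "'a::metric_space measure"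
  assumes \<mu>: "prob_space \<mu>" "sets \<mu> = sets borel" and f: "f \<in> Lip"
    and K: "closed K"
    and q[measurable]: "q \<in> borel_measurable borel" "\<And>y. y \<in> K \<Longrightarrow> ereal (q y) \<le> perimeter \<mu> {x. y < f x}"
  shows "(\<integral>\<^sup>+y\<in>K. ennreal (q y) \<partial>lborel) \<le> (\<integral>\<^sup>+x\<in>f -` K. ennreal (grad_mod f x) \<partial>\<mu>)"
proof -
  interpret prob_space \<mu> by fact
  note [measurable_cong] = \<mu>(2)
  have sp: "space \<mu> = UNIV" using sets_eq_imp_space_eq[OF \<mu>(2)] by simp
  obtain L where L: "0 \<le> L" "\<And>x y. \<bar>f x - f y\<bar> \<le> L * dist x y"
    using LipE[OF f] by blast
  define h where "h n = 1 / real (Suc n)" for n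
  have h: "0 < h n" for n by (simp add: h_def)
  have hlim: "filterlim h (at_right 0) sequentially"
    unfolding h_def filterlim_at using LIMSEQ_Suc[OF lim_1_over_n] by auto
  have hdec: "m \<le> n \<Longrightarrow> h n \<le> h m" for m n by (simp add: h_def field_simps)
  have [measurable]: "K \<in> sets borel" using K by auto
  have fm[measurable]: "f \<in> borel_measurable \<mu>"
    using borel_measurable_Lip[OF f] by measurable
  have gm[measurable]: "sup_ball f (h n) \<in> borel_measurable \<mu>" for n
    using borel_measurable_sup_ball[OF f h] by measurable
  \<comment> \<open>\<open>m n y\<close> is the measure of the ring of width \<open>h n\<close>
    around \<open>{f > y}\<close>, and \<open>\<phi> n x\<close> is the length of the set of levels
    in \<open>K\<close> swept at \<open>x\<close>, divided by \<open>h n\<close>.\<close>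
  define m where "m n y = emeasure \<mu> {x \<in> space \<mu>. f x \<le> y \<and> y < sup_ball f (h n) x}" for n y
  define \<phi> where "\<phi> n x = ennreal (1 / h n) * emeasure lborel (K \<inter> {f x..<sup_ball f (h n) x})" for n x
  have meq: "m n y = ennreal (measure \<mu> (nbhd {x. y < f x} (h n)) - measure \<mu> {x. y < f x})" for n y
  proof -
    have o: "{x. y < f x} \<in> sets \<mu>"
      using fm sp by (auto simp: \<mu>(2) intro!: borel_open open_Collect_less continuous_on_Lip[OF f] continuous_on_const)
    have o': "nbhd {x. y < f x} (h n) \<in> sets \<mu>"
      by (simp add: \<mu>(2) borel_open[OF open_nbhd])
    have "{x \<in> space \<mu>. f x \<le> y \<and> y < sup_ball f (h n) x} = nbhd {x. y < f x} (h n) - {x. y < f x}"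
      using sp by (auto simp: less_sup_ball_iff[OF f h] not_less)
    then show ?thesis
      unfolding m_def using subset_nbhd[OF h] o o' by (simp add: emeasure_eq_measure finite_measure_Diff[OF o' o subset_nbhd[OF h]])
  qed
  have mm[measurable]: "m n \<in> borel_measurable borel" for n
  proof -
    have o: "{x. y < f x} \<in> sets \<mu>" "nbhd {x. y < f x} t \<in> sets \<mu>" for y t
      using open_nbhd \<mu>(2)
      by (auto intro!: borel_open open_Collect_less continuous_on_Lip[OF f] continuous_on_const)
    have m1: "mono (\<lambda>y. - measure \<mu> {x. y < f x})"
      by (intro monoI le_imp_neg_le finite_measure_mono o) auto
    have m2: "mono (\<lambda>y. - measure \<mu> (nbhd {x. y < f x} (h n)))"
      by (intro monoI le_imp_neg_le finite_measure_mono o) (force simp: nbhd_def)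
    have "(\<lambda>y. ennreal (- (- measure \<mu> (nbhd {x. y < f x} (h n))) - - (- measure \<mu> {x. y < f x}))) \<in> borel_measurable borel"
      using borel_measurable_mono[OF m1] borel_measurable_mono[OF m2] by measurable
    then show ?thesis by (simp add: meq[abs_def])
  qed
  have phi: "\<phi> n x \<le> slope_sup f (h n) x" for n x
  proof -
    have "\<phi> n x \<le> ennreal (1 / h n) * emeasure lborel {f x..<sup_ball f (h n) x}"
      unfolding \<phi>_def by (intro mult_left_mono emeasure_mono) auto
    also have "\<dots> = ennreal ((sup_ball f (h n) x - f x) / h n)"
      using le_sup_ball[OF f h, of x n] h[of n] by (simp add: ennreal_mult'[symmetric])
    finally show ?thesis
      using sup_ball_diff_le_slope_sup[OF f h] order_trans by blast
  qed
  have \<phi>m[measurable]: "\<phi> n \<in> borel_measurable \<mu>" for n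
    unfolding \<phi>_def
    by (intro borel_measurable_times_ennreal borel_measurable_const borel_measurable_emeasure_Int_Ico) measurable
  have "(\<integral>\<^sup>+y\<in>K. ennreal (q y) \<partial>lborel) \<le> (\<integral>\<^sup>+y. liminf (\<lambda>n. ennreal (1 / h n) * m n y * indicator K y) \<partial>lborel)"
  proof (intro nn_integral_mono)
    fix y
    show "ennreal (q y) * indicator K y \<le> liminf (\<lambda>n. ennreal (1 / h n) * m n y * indicator K y)"
    proof (cases "y \<in> K")
      case True
      \<comment> \<open>The perimeter is a lower limit over all widths tending to 0 from the right;
        along the sequence \<open>h n\<close> it can only be larger. Constants below
        \<open>q y\<close> bridge \<open>ereal\<close> and \<open>ennreal\<close>.\<close>
      have "ennreal (q y) \<le> liminf (\<lambda>n. ennreal (1 / h n) * m n y)"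
        unfolding le_Liminf_iff
      proof (intro allI impI)
        fix c assume c: "c < ennreal (q y)"
        then obtain c' where c': "c = ennreal c'" "0 \<le> c'" "c' < q y"
          by (cases c) (auto simp: ennreal_less_iff)
        have "eventually (\<lambda>t. ereal c' < ereal ((measure \<mu> (nbhd {x. y < f x} t) - measure \<mu> {x. y < f x}) / t)) (at_right 0)"
          using q(2)[OF True, unfolded perimeter_def le_Liminf_iff] less_ereal.simps(1) c'(3) by blast
        then have "eventually (\<lambda>n. ereal c' < ereal ((measure \<mu> (nbhd {x. y < f x} (h n)) - measure \<mu> {x. y < f x}) / h n)) sequentially"
          using hlim unfolding filterlim_iff by blast
        then show "\<forall>\<^sub>F n in sequentially. c < ennreal (1 / h n) * m n y"
        proof eventually_elim
          case (elim n)
          then show ?case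
            using c' h[of n] by (simp add: meq c'(1) ennreal_mult'[symmetric] ennreal_less_iff)
        qed
      qed
      then show ?thesis using True by simp
    qed simp
  qed
  also have "\<dots> \<le> liminf (\<lambda>n. \<integral>\<^sup>+y. ennreal (1 / h n) * m n y * indicator K y \<partial>lborel)"
    by (intro nn_integral_liminf) measurable
  also have "\<dots> = liminf (\<lambda>n. \<integral>\<^sup>+x. \<phi> n x \<partial>\<mu>)"
  proof -
    have "(\<integral>\<^sup>+y. ennreal (1 / h n) * m n y * indicator K y \<partial>lborel) = (\<integral>\<^sup>+x. \<phi> n x \<partial>\<mu>)" for n
      
    proof -
      have "(\<integral>\<^sup>+y. ennreal (1 / h n) * m n y * indicator K y \<partial>lborel) = ennreal (1 / h n) * (\<integral>\<^sup>+y\<in>K. m n y \<partial>lborel)"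
        by (simp add: mult.assoc nn_integral_cmult)
      also have "(\<integral>\<^sup>+y\<in>K. m n y \<partial>lborel) = (\<integral>\<^sup>+x. emeasure lborel (K \<inter> {f x..<sup_ball f (h n) x}) \<partial>\<mu>)"
        unfolding m_def by (rule layer_cake[OF \<mu>(1), symmetric]) measurable
      also have "ennreal (1 / h n) * \<dots> = (\<integral>\<^sup>+x. \<phi> n x \<partial>\<mu>)"
        unfolding \<phi>_def
          by (intro nn_integral_cmult[symmetric] borel_measurable_emeasure_Int_Ico) measurable
      finally show ?thesis .
    qed
    then show ?thesis by simp
  qed
  also have "\<dots> \<le> limsup (\<lambda>n. \<integral>\<^sup>+x. \<phi> n x \<partial>\<mu>)"
    by (intro Liminf_le_Limsup) simp
  \<comment> \<open>Reverse Fatou: the Lipschitz constant \<open>L\<close> is an integrable majorant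
    on a probability space.\<close>
  also have "\<dots> \<le> (\<integral>\<^sup>+x. limsup (\<lambda>n. \<phi> n x) \<partial>\<mu>)"
  proof (rule nn_integral_limsup[where w="\<lambda>_. ennreal L"])
    show "AE x in \<mu>. \<phi> n x \<le> ennreal L" for n
      by (intro AE_I2 order_trans[OF phi slope_sup_le_Lip[OF L]])
  qed (simp_all add: emeasure_space_1)
  also have "\<dots> \<le> (\<integral>\<^sup>+x\<in>f -` K. ennreal (grad_mod f x) \<partial>\<mu>)"
  proof (intro nn_integral_mono)
    fix x
    show "limsup (\<lambda>n. \<phi> n x) \<le> ennreal (grad_mod f x) * indicator (f -` K) x"
    proof (cases "f x \<in> K")
      case True
      have "limsup (\<lambda>n. \<phi> n x) \<le> slope_sup f (h N) x" for N
        by (intro Limsup_bounded eventually_mono[OF eventually_ge_at_top[of N]]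
            order_trans[OF phi slope_sup_mono] hdec)
      then show ?thesis
        using True by (simp add: ennreal_grad_mod[OF f] h_def le_INF_iff)
    next
      case False
      then obtain e where e: "0 < e" "\<And>y. dist y (f x) < e \<Longrightarrow> y \<notin> K"
        using K open_dist[of "- K"] by (auto simp: open_Compl)
      have "(\<lambda>n. f x + L * h n) \<longlonglongrightarrow> f x + L * 0"
        using hlim by (intro tendsto_intros) (simp add: filterlim_at)
      then have "eventually (\<lambda>n. f x + L * h n < f x + e) sequentially"
        using e(1) by (intro order_tendstoD) auto
      then have "eventually (\<lambda>n. \<phi> n x \<le> 0) sequentially"
      proof eventually_elim
        case (elim n)
        have "sup_ball f (h n) x \<le> f x + L * h n"
          unfolding sup_ball_def
        proof (rule cSUP_least)
          fix y assume "y \<in> ball x (h n)"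
          then have "L * dist y x \<le> L * h n"
            using L(1) by (intro mult_left_mono) (auto simp: dist_commute)
          then show "f y \<le> f x + L * h n" using L(2)[of y x] by linarith
        qed (use h[of n] in auto)
        then have "K \<inter> {f x..<sup_ball f (h n) x} = {}"
          using elim e(2) by (force simp: dist_real_def)
        then show ?case by (simp add: \<phi>_def)
      qed
      then have "limsup (\<lambda>n. \<phi> n x) \<le> 0" by (rule Limsup_bounded)
      then show ?thesis by simp
    qed
  qed
  finally show ?thesis .
qed


text \<open>Exhaustion of \<open>S\<close> by compact sets. An open interval of levels leaves out
  the level sets at its end points, which may have positive measure and whose gradient would
  otherwise enter the right-hand side.\<close>

lemma coarea_open:
  fixes \<mu> :: "'a::metric_space measure"
  assumes \<mu>: "prob_space \<mu>" "sets \<mu> = sets borel" and f: "f \<in> Lip"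
    and S: "open S"
    and q[measurable]: "q \<in> borel_measurable borel" "\<And>y. y \<in> S \<Longrightarrow> ereal (q y) \<le> perimeter \<mu> {x. y < f x}"
  shows "(\<integral>\<^sup>+y\<in>S. ennreal (q y) \<partial>lborel) \<le> (\<integral>\<^sup>+x\<in>f -` S. ennreal (grad_mod f x) \<partial>\<mu>)"
proof -
  obtain C where C: "\<And>n::nat. compact (C n)" "\<And>n. C n \<subseteq> S" "\<And>n. C n \<subseteq> interior (C (Suc n))"
    "\<Union>(range C) = S"
    using open_Union_compact_subsets[OF S] by metis
  have inc: "incseq C"
    using C(3) interior_subset by (intro incseq_SucI) blast
  have [measurable]: "C n \<in> sets borel" "S \<in> sets borel" for n
    using borel_closed[OF compact_imp_closed[OF C(1)]] S by auto
  let ?N = "density lborel (\<lambda>y. ennreal (q y))"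
  have "(\<integral>\<^sup>+y\<in>S. ennreal (q y) \<partial>lborel) = emeasure ?N S"
    by (simp add: emeasure_density)
  also have "\<dots> = (SUP n. emeasure ?N (C n))"
    using inc by (subst SUP_emeasure_incseq) (auto simp: C(4))
  also have "\<dots> \<le> (\<integral>\<^sup>+x\<in>f -` S. ennreal (grad_mod f x) \<partial>\<mu>)"
  proof (rule SUP_least)
    fix n
    have "emeasure ?N (C n) = (\<integral>\<^sup>+y\<in>C n. ennreal (q y) \<partial>lborel)"
      by (simp add: emeasure_density)
    also have "\<dots> \<le> (\<integral>\<^sup>+x\<in>f -` C n. ennreal (grad_mod f x) \<partial>\<mu>)"
      using C(2) by (intro coarea_closed[OF \<mu> f compact_imp_closed[OF C(1)]] q) auto
    also have "\<dots> \<le> (\<integral>\<^sup>+x\<in>f -` S. ennreal (grad_mod f x) \<partial>\<mu>)"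
      using C(2)[of n] by (intro nn_integral_mono) (auto split: split_indicator)
    finally show "emeasure ?N (C n) \<le> (\<integral>\<^sup>+x\<in>f -` S. ennreal (grad_mod f x) \<partial>\<mu>)" .
  qed
  finally show ?thesis .
qed

subsection \<open>Rearrangement in slices\<close>

lemma measurable_leb01: "g \<in> borel_measurable borel \<Longrightarrow> g \<in> borel_measurable leb01"
  by (intro measurable_restrict_space1 measurable_completion) simp

text \<open>The rearrangement is at least its value at \<open>s\<close> on all of
  \<open>(0,s)\<close>, and the laws agree. With \<open>rearr_le_iff\<close> this places
  \<open>s\<close> between the measures of the strict and the non-strict superlevel set.\<close>

lemma rearr_superlevel_ge:
  assumes M: "prob_space M" and u: "u \<in> borel_measurable M" and s: "0 < s" "s < 1"
  shows "s \<le> measure M {x \<in> space M. rearr M u s \<le> u x}"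
proof -
  interpret L: prob_space leb01 by (rule prob_space_leb01)
  let ?b = "rearr M u s"
  note r[measurable] = borel_measurable_rearr[OF M u]
  have "s = measure leb01 {0<..<s}"
    using s by (subst measure_leb01) auto
  also have "\<dots> \<le> measure leb01 {r \<in> space leb01. ?b \<le> rearr M u r}"
  proof (rule L.finite_measure_mono)
    show "{0<..<s} \<subseteq> {r \<in> space leb01. ?b \<le> rearr M u r}"
      using s by (auto intro!: rearr_antimono[OF M u])
  qed measurable
  also have "\<dots> = measure (distr leb01 borel (rearr M u)) {?b..}"
    using r by (auto simp: measure_distr intro!: arg_cong[where f="measure leb01"])
  also have "\<dots> = measure M {x \<in> space M. ?b \<le> u x}"
    unfolding distr_rearr[OF M u]
    using u by (auto simp: measure_distr intro!: arg_cong[where f="measure M"])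
  finally show ?thesis .
qed

text \<open>The Hardy operators are Bochner integrals, whereas the estimates use nonnegative
  integrals. Finiteness guards against the default value 0 of a Bochner integral that does not
  exist.\<close>

lemma set_integral_leb01:
  assumes g: "g \<in> borel_measurable leb01" and D: "D \<in> sets lebesgue" "D \<subseteq> {0<..<1}"
    and nn: "\<And>x. x \<in> D \<Longrightarrow> 0 \<le> g x" and fin: "(\<integral>\<^sup>+x\<in>D. ennreal (g x) \<partial>leb01) < \<infinity>"
  shows "set_integrable lebesgue D g"
    and "ennreal (LINT x:D|lebesgue. g x) = (\<integral>\<^sup>+x\<in>D. ennreal (g x) \<partial>leb01)"
proof -
  have m: "(\<lambda>x. indicator D x *\<^sub>R g x) \<in> borel_measurable lebesgue"
  proof -
    have "(\<lambda>x. indicator {0<..<1} x *\<^sub>R g x) \<in> borel_measurable lebesgue"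
      using g by (subst (asm) borel_measurable_restrict_space_iff) auto
    then have "(\<lambda>x. indicator D x *\<^sub>R (indicator {0<..<1} x *\<^sub>R g x)) \<in> borel_measurable lebesgue"
      by (rule borel_measurable_scaleR[OF borel_measurable_indicator[OF D(1)]])
    also have "(\<lambda>x. indicator D x *\<^sub>R (indicator {0<..<1} x *\<^sub>R g x)) = (\<lambda>x. indicator D x *\<^sub>R g x)"
      using D(2) by (intro ext) (auto split: split_indicator)
    finally show ?thesis .
  qed
  have eq: "(\<integral>\<^sup>+x. ennreal (indicator D x *\<^sub>R g x) \<partial>lebesgue) = (\<integral>\<^sup>+x\<in>D. ennreal (g x) \<partial>leb01)"
    using D(2) by (subst nn_integral_restrict_space) (auto intro!: nn_integral_cong split: split_indicator)
  have nn': "0 \<le> indicator D x *\<^sub>R g x" for x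
    using nn by (auto split: split_indicator)
  show i: "set_integrable lebesgue D g"
    unfolding set_integrable_def
    by (rule integrableI_nonneg) (use m nn' eq fin in auto)
  show "ennreal (LINT x:D|lebesgue. g x) = (\<integral>\<^sup>+x\<in>D. ennreal (g x) \<partial>leb01)"
    using i nn' unfolding set_integrable_def set_lebesgue_integral_def eq[symmetric]
    by (intro nn_integral_eq_integral[symmetric]) auto
qed

text \<open>The function \<open>h\<close> is \<open>\<psi>\<close> of the rearrangement
  \<open>V\<close> of one function \<open>U\<close> that codes both the slice and the value of
  \<open>w\<close>, so \<open>h\<close> and \<open>w\<close> are equimeasurable as a whole and slice
  by slice. A slice of the unit interval is an interval on which \<open>h\<close> increases; its
  part to the right of \<open>s\<close> therefore carries at least the integral of \<open>w\<close>
  over any part of the corresponding slice of no larger measure.\<close>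

lemma layered_rearrangement:
  fixes a :: "nat \<Rightarrow> real"
  assumes M: "prob_space M" and f[measurable]: "f \<in> borel_measurable M"
    and w[measurable]: "w \<in> borel_measurable M" and w0: "\<And>x. 0 \<le> w x"
    and a: "mono a"
  obtains h where "h \<in> borel_measurable leb01" "\<And>s. 0 \<le> h s" "rearr leb01 h = rearr M w"
    "(\<integral>\<^sup>+s. ennreal (h s) \<partial>leb01) = (\<integral>\<^sup>+x. ennreal (w x) \<partial>M)"
    "\<And>i b s. \<lbrakk>i < n; b \<le> a (Suc i); measure M {x \<in> space M. a (Suc i) < f x} \<le> s;
        s \<le> measure M {x \<in> space M. b \<le> f x}\<rbrakk> \<Longrightarrow>
      (\<integral>\<^sup>+x\<in>{x \<in> space M. a i < f x \<and> f x < b}. ennreal (w x) \<partial>M)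
      \<le> (\<integral>\<^sup>+r\<in>{s..<measure M {x \<in> space M. a i < f x}}. ennreal (h r) \<partial>leb01)"
proof -
  interpret prob_space M by fact
  interpret L: prob_space leb01 by (rule prob_space_leb01)
  \<comment> \<open>The number of levels among \<open>a 0, ..., a n\<close> strictly below
    \<open>y\<close>; by monotonicity of \<open>a\<close> they form an initial segment.\<close>
  define k where "k y = card {j. j \<le> n \<and> a j < y}" for y
  have k_iff: "Suc i \<le> k y \<longleftrightarrow> a i < y" if "i \<le> n" for i y
  proof
    assume "a i < y"
    then have "{..i} \<subseteq> {j. j \<le> n \<and> a j < y}"
      using that monoD[OF a] by (force intro: le_less_trans)
    from card_mono[OF _ this] show "Suc i \<le> k y" by (simp add: k_def)
  next
    assume k: "Suc i \<le> k y"
    show "a i < y"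
    proof (rule ccontr)
      assume "\<not> a i < y"
      then have "{j. j \<le> n \<and> a j < y} \<subseteq> {..<i}"
        using monoD[OF a] by (force intro: order_trans simp: not_le[symmetric])
      from card_mono[OF _ this] show False using k by (simp add: k_def)
    qed
  qed
  text \<open>
    The integer part of \<open>U\<close> encodes the slice and its fractional part the value of \<open>w\<close>, in reversed order,
    so that \<open>\<psi>\<close> recovers \<open>w\<close> from \<open>U\<close> and \<open>\<psi>\<close> of the rearrangement of \<open>U\<close> increases within each slice.
  \<close>
  define U where "U x = real (k (f x)) + 1 / (1 + w x)" for x
  define \<psi> :: "real \<Rightarrow> real" where "\<psi> u = 1 / (u - of_int \<lceil>u\<rceil> + 1) - 1" for u
  have \<psi>m[measurable]: "\<psi> \<in> borel_measurable borel"
    unfolding \<psi>_def by measurable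
  have \<psi>0: "0 \<le> \<psi> u" for u
  proof -
    have "0 < u - of_int \<lceil>u\<rceil> + 1" "u - of_int \<lceil>u\<rceil> + 1 \<le> 1" by linarith+
    then show ?thesis by (simp add: \<psi>_def)
  qed
  have km: "(\<lambda>y. real (k y)) = (\<lambda>y. \<Sum>j\<le>n. indicator {a j<..} y)"
  proof
    fix y
    show "real (k y) = (\<Sum>j\<le>n. indicator {a j<..} y)"
      by (simp add: k_def indicator_def of_bool_def sum.If_cases Int_def)
  qed
  have [measurable]: "(\<lambda>y. real (k y)) \<in> borel_measurable borel"
    unfolding km by simp
  have U[measurable]: "U \<in> borel_measurable M"
    unfolding U_def by measurable
  \<comment> \<open>The part added to the integer lies in \<open>(0,1]\<close>, with the value 1
    where \<open>w\<close> vanishes; this is why \<open>\<psi>\<close> decodes with the ceiling and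
    not with the floor.\<close>
  have frac: "0 < 1 / (1 + w x)" "1 / (1 + w x) \<le> 1" for x
    using w0[of x] by auto
  have \<psi>U: "\<psi> (U x) = w x" for x
  proof -
    have "\<lceil>U x\<rceil> = int (k (f x)) + 1"
      unfolding U_def ceiling_eq_iff using frac[of x] by simp
    then show ?thesis
      using w0[of x] by (simp add: \<psi>_def U_def)
  qed
  \<comment> \<open>\<open>U x\<close> lies above \<open>k (f x)\<close> and is at most
    \<open>k (f x) + 1\<close>. The slice \<open>a i < f x \<le> a (Suc i)\<close> thus corresponds
    to values of \<open>U\<close> in \<open>(i + 1, i + 2]\<close>.\<close>
  have U_iff: "real i + 1 < U x \<longleftrightarrow> a i < f x" if "i \<le> n" for i x
  proof -
    have "real i + 1 < U x \<longleftrightarrow> Suc i \<le> k (f x)"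
    proof (cases "Suc i \<le> k (f x)")
      case True
      then have "real i + 1 \<le> real (k (f x))" by simp
      then have "real i + 1 < U x" using frac[of x] unfolding U_def by linarith
      then show ?thesis using True by simp
    next
      case False
      then have "real (k (f x)) \<le> real i" by simp
      then have "\<not> real i + 1 < U x" using frac[of x] unfolding U_def by linarith
      then show ?thesis using False by simp
    qed
    then show ?thesis using k_iff[OF that] by simp
  qed
  define V where "V = rearr M U"
  have V[measurable]: "V \<in> borel_measurable leb01"
    unfolding V_def by (rule borel_measurable_rearr[OF M U])
  define e where "e i = measure M {x \<in> space M. a i < f x}" for i
  have V_iff: "real i + 1 < V r \<longleftrightarrow> r < e i" if "i \<le> n" "0 < r" "r < 1" for i r
    unfolding V_def e_def less_rearr_iff[OF M U that(2,3)] using U_iff[OF that(1)] by simp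
  show thesis
  proof
    show "(\<lambda>s. \<psi> (V s)) \<in> borel_measurable leb01" by measurable
    show "0 \<le> \<psi> (V s)" for s by (rule \<psi>0)
    show "rearr leb01 (\<lambda>s. \<psi> (V s)) = rearr M w"
      unfolding V_def by (subst rearr_comp_rearr[OF M U \<psi>m]) (simp add: \<psi>U)
    show "(\<integral>\<^sup>+s. ennreal (\<psi> (V s)) \<partial>leb01) = (\<integral>\<^sup>+x. ennreal (w x) \<partial>M)"
      unfolding V_def by (subst nn_integral_rearr[OF M U, of "\<lambda>u. ennreal (\<psi> u)"]) (auto simp: \<psi>U)
    fix i b s
    assume i: "i < n" and b: "b \<le> a (Suc i)" and s: "measure M {x \<in> space M. a (Suc i) < f x} \<le> s"
      "s \<le> measure M {x \<in> space M. b \<le> f x}"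
    let ?E = "{x \<in> space M. a i < f x \<and> f x < b}"
    let ?D = "{r \<in> space leb01. s \<le> r \<and> r < e i}"
    let ?A = "{x \<in> space M. real i + 1 < U x \<and> U x \<le> real (Suc i) + 1}"
    let ?B = "{r \<in> space leb01. real i + 1 < V r \<and> V r \<le> real (Suc i) + 1}"
    \<comment> \<open>The threshold is the value of the new function at the left end of
      \<open>?D\<close>. For \<open>s = 0\<close> the rearrangement has no meaningful value there;
      then \<open>?D\<close> is all of \<open>?B\<close> and the threshold 0 serves.\<close>
    define c where "c = (if s = 0 then 0 else ennreal (\<psi> (V s)))"
    have s0: "0 \<le> s" and s1: "s \<le> 1"
      using s measure_nonneg order_trans prob_le_1 by blast+
    have id: "(\<lambda>r::real. r) \<in> borel_measurable leb01" by (rule measurable_leb01) simp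
    have A_eq: "?A = {x \<in> space M. a i < f x \<and> f x \<le> a (Suc i)}"
      using i U_iff[of i] U_iff[of "Suc i"] by (auto simp: not_less[symmetric])
    have B_eq: "?B = {r \<in> space leb01. e (Suc i) \<le> r \<and> r < e i}"
      using i V_iff[of i] V_iff[of "Suc i"] by (auto simp: not_less[symmetric])
    have E: "emeasure M ?E \<le> ennreal (e i - s)"
    proof (cases "a i < b")
      case True
      have "measure M ?E = measure M ({x \<in> space M. a i < f x} - {x \<in> space M. b \<le> f x})"
        by (intro arg_cong[where f="measure M"]) auto
      also have "\<dots> = e i - measure M {x \<in> space M. b \<le> f x}"
        unfolding e_def using True by (intro finite_measure_Diff) auto
      finally show ?thesis
        using s by (simp add: emeasure_eq_measure ennreal_leI)
    next
      case False
      then have "?E = {}" by auto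
      then show ?thesis by (metis emeasure_empty zero_le)
    qed
    have D_meas: "emeasure leb01 ?D = ennreal (e i - s)"
    proof -
      have e1: "e i \<le> 1" by (simp add: e_def)
      have "emeasure leb01 ?D = emeasure lebesgue ({0<..<1} \<inter> {s..<e i})"
        by (subst emeasure_restrict_space) (auto intro!: arg_cong[where f="emeasure lborel"])
      also have "\<dots> = emeasure lebesgue {s..<e i}"
      proof (rule emeasure_eq_AE)
        have "AE x in lebesgue. x \<noteq> (0::real)"
          by (rule AE_completion) (rule AE_lborel_singleton)
        then show "AE x in lebesgue. (x \<in> {0<..<1} \<inter> {s..<e i}) = (x \<in> {s..<e i})"
          by eventually_elim (use s0 e1 in auto)
      qed auto
      also have "\<dots> = ennreal (e i - s)"
        by (cases "s \<le> e i") (auto simp: ennreal_neg)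
      finally show ?thesis .
    qed
    have "(\<integral>\<^sup>+x\<in>?E. ennreal (w x) \<partial>M) \<le> (\<integral>\<^sup>+r\<in>?D. ennreal (\<psi> (V r)) \<partial>leb01)"
    proof (cases "s < e i")
      case False
      then have "emeasure M ?E = 0"
        using E by (simp add: ennreal_neg)
      then have "?E \<in> null_sets M"
        by (intro null_setsI) measurable
      then show ?thesis
        by (simp add: nn_integral_null_set)
    next
      case se: True
      show ?thesis
      proof (rule bathtub[where A="?A" and B="?B" and c=c])
        show "?D \<in> sets leb01" using id by measurable
        show "?E \<subseteq> ?A" unfolding A_eq using b by auto
        show "?D \<subseteq> ?B" unfolding B_eq using s by (auto simp: e_def)
        show "c < \<infinity>" by (simp add: c_def)
        show "emeasure M ?E \<le> emeasure leb01 ?D" using E D_meas by simp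
        \<comment> \<open>The excess over \<open>c\<close>, cut off to the slice, is one Borel
          function, applied to \<open>U\<close> on the left and to \<open>V\<close> on the
          right.\<close>
        show "(\<integral>\<^sup>+x\<in>?A. (ennreal (w x) - c) \<partial>M) = (\<integral>\<^sup>+r\<in>?B. (ennreal (\<psi> (V r)) - c) \<partial>leb01)"
        proof -
          let ?F = "\<lambda>u. (ennreal (\<psi> u) - c) * indicator {real i + 1<..real (Suc i) + 1} u"
          have "(\<integral>\<^sup>+r. ?F (V r) \<partial>leb01) = (\<integral>\<^sup>+x. ?F (U x) \<partial>M)"
            unfolding V_def by (intro nn_integral_rearr[OF M U]) measurable
          moreover have "(\<integral>\<^sup>+r. ?F (V r) \<partial>leb01) = (\<integral>\<^sup>+r\<in>?B. (ennreal (\<psi> (V r)) - c) \<partial>leb01)"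
            by (intro nn_integral_cong) (auto split: split_indicator)
          moreover have "(\<integral>\<^sup>+x. ?F (U x) \<partial>M) = (\<integral>\<^sup>+x\<in>?A. (ennreal (w x) - c) \<partial>M)"
            by (intro nn_integral_cong) (auto split: split_indicator simp: \<psi>U)
          ultimately show ?thesis by simp
        qed
        \<comment> \<open>The ceiling is constant on a slice, so \<open>\<psi>\<close> decreases
          there; composed with the decreasing \<open>V\<close> it increases.\<close>
        have anti: "\<psi> (V r) \<le> \<psi> (V r')" if "r \<le> r'" "r \<in> ?B" "r' \<in> ?B" for r r'
        proof -
          have ceil: "\<lceil>V q\<rceil> = int i + 2" if "q \<in> ?B" for q
            using that unfolding ceiling_eq_iff by simp
          have "V r' \<le> V r"
            unfolding V_def using that by (intro rearr_antimono[OF M U]) auto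
          then show ?thesis
            using that(2,3) ceil[OF that(2)] ceil[OF that(3)] by (simp add: \<psi>_def frac_le)
        qed
        fix r
        show "c \<le> ennreal (\<psi> (V r))" if r: "r \<in> ?D"
        proof (cases "s = 0")
          case False
          have "s \<in> ?B" "r \<in> ?B"
            unfolding B_eq using False s0 s(1) r by (auto simp: e_def)
          then show ?thesis
            unfolding c_def using anti[of s r] r False by (auto intro: ennreal_leI)
        qed (simp add: c_def)
        show "ennreal (\<psi> (V r)) \<le> c" if r: "r \<in> ?B - ?D"
        proof -
          have s_pos: "s \<noteq> 0"
            using r unfolding B_eq by auto
          with se have "s \<in> ?B" "r \<in> ?B" "r \<le> s"
            using r s0 s(1) prob_le_1[of "{x \<in> space M. a i < f x}"] unfolding B_eq
            by (auto simp: e_def simp del: prob_le_1 intro: less_le_trans)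
          then show ?thesis
            unfolding c_def using anti[of r s] s_pos by (auto intro: ennreal_leI)
        qed
      qed measurable
    qed
    also have "\<dots> = (\<integral>\<^sup>+r\<in>{s..<measure M {x \<in> space M. a i < f x}}. ennreal (\<psi> (V r)) \<partial>leb01)"
      by (intro nn_integral_cong) (auto split: split_indicator simp: e_def)
    finally show "(\<integral>\<^sup>+x\<in>?E. ennreal (w x) \<partial>M)
      \<le> (\<integral>\<^sup>+r\<in>{s..<measure M {x \<in> space M. a i < f x}}. ennreal (\<psi> (V r)) \<partial>leb01)" .
  qed
qed

subsection \<open>Consequences of the isoperimetric inequality\<close>

text \<open>Concavity between 0 and \<open>t\<close> compares the ratios. Monotonicity up to 1/2 is
  concavity between \<open>s\<close> and \<open>1 - s\<close>, where \<open>\<phi>\<close> takes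
  equal values by symmetry.\<close>

lemma profile_shapeD:
  assumes "profile_shape \<phi>" "\<And>t. t \<in> {0..1/2} \<Longrightarrow> 0 \<le> \<phi> t" "0 \<le> s" "s \<le> t" "t \<le> 1/2"
  shows "\<phi> s \<le> \<phi> t" "\<phi> t * s \<le> \<phi> s * t"
proof -
  have conc: "(1 - u) * \<phi> x + u * \<phi> y \<le> \<phi> ((1 - u) * x + u * y)"
    if "u \<in> {0..1}" "x \<in> {0..1}" "y \<in> {0..1}" for u x y
    using assms(1) concave_onD[of "{0..1}" \<phi> u x y] that by (auto simp: profile_shape_def)
  have \<phi>0: "\<phi> 0 = 0" and sym: "\<phi> (1 - s) = \<phi> s"
    using assms by (auto simp: profile_shape_def)
  show "\<phi> t * s \<le> \<phi> s * t"
  proof (cases "t = 0")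
    case False
    then have "0 < t" using assms by auto
    then show ?thesis
      using conc[of "s / t" 0 t] assms(3-5) \<phi>0 by (simp add: field_simps)
  qed (use assms in auto)
  show "\<phi> s \<le> \<phi> t"
  proof (cases "s = t")
    case False
    then have u: "(t - s) / (1 - 2 * s) \<in> {0..1}" and s2: "1 - 2 * s > 0"
      using assms(3-5) by (auto simp: divide_le_eq)
    have "(1 - (t - s) / (1 - 2 * s)) * s + (t - s) / (1 - 2 * s) * (1 - s)
        = s + (t - s) / (1 - 2 * s) * (1 - 2 * s)"
      by (simp only: ring_distribs) simp
    also have "\<dots> = t" using s2 by simp
    finally show ?thesis
      using conc[OF u, of s "1 - s"] assms(3-5) by (simp add: sym algebra_simps)
  qed simp
qed

text \<open>Positivity of \<open>J\<close> is assumed separately, since the zero function is an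
  isoperimetric estimator too; in the application it comes from the finite weight integral
  (\<open>isop_estimator_pos\<close>).\<close>

locale estimator =
  fixes \<mu> :: "'a::metric_space measure" and J :: "real \<Rightarrow> real"
  assumes prob: "prob_space \<mu>" and sets_borel: "sets \<mu> = sets borel"
    and est: "isop_estimator \<mu> J"
    and J_pos: "\<And>t. 0 < t \<Longrightarrow> t < 1/2 \<Longrightarrow> 0 < J t"
begin

sublocale prob_space \<mu> by (rule prob)

lemma space_UNIV: "space \<mu> = UNIV"
  using sets_eq_imp_space_eq[OF sets_borel] by simp

lemma measurable_borel: "u \<in> borel_measurable borel \<Longrightarrow> u \<in> borel_measurable \<mu>"
  using measurable_cong_sets[OF sets_borel refl] by blast

lemma J_mono: "0 \<le> s \<Longrightarrow> s \<le> t \<Longrightarrow> t \<le> 1/2 \<Longrightarrow> J s \<le> J t"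
  and J_ratio: "0 \<le> s \<Longrightarrow> s \<le> t \<Longrightarrow> t \<le> 1/2 \<Longrightarrow> J t * s \<le> J s * t"
proof -
  obtain \<phi> where p: "profile_shape \<phi>" "\<And>t. t \<in> {0..1/2} \<Longrightarrow> J t = \<phi> t" "\<And>t. t \<in> {0..1/2} \<Longrightarrow> 0 \<le> \<phi> t"
    using est unfolding isop_estimator_def by force
  assume "0 \<le> s" "s \<le> t" "t \<le> 1/2"
  then show "J s \<le> J t" "J t * s \<le> J s * t"
    using profile_shapeD[OF p(1,3), of s t] p(2)[of s] p(2)[of t] by auto
qed

lemma ratio_mono: "0 < s \<Longrightarrow> s \<le> t \<Longrightarrow> t < 1/2 \<Longrightarrow> s / J s \<le> t / J t"
  using J_ratio[of s t] J_pos[of s] J_pos[of t] by (simp add: field_simps)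

lemma J_le_perimeter:
  assumes "open A" "0 < measure \<mu> A" "measure \<mu> A < 1/2"
  shows "ereal (J (measure \<mu> A)) \<le> perimeter \<mu> A"
proof -
  have "ereal (J (measure \<mu> A)) \<le> isop_profile \<mu> (measure \<mu> A)"
    using est assms by (simp add: isop_estimator_def)
  also have "\<dots> \<le> perimeter \<mu> A"
    unfolding isop_profile_def using assms(1) by (intro INF_lower) (auto simp: sets_borel)
  finally show ?thesis .
qed

text \<open>For the levels whose superlevel set is null, where the estimator gives no bound: a set
  lies in its neighbourhoods, so no difference quotient is negative.\<close>

lemma perimeter_nonneg:
  assumes "open A"
  shows "0 \<le> perimeter \<mu> A"
  unfolding perimeter_def
proof (rule Liminf_bounded)
  show "\<forall>\<^sub>F h in at_right 0. 0 \<le> ereal ((measure \<mu> (nbhd A h) - measure \<mu> A) / h)"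
    using eventually_at_right_less[of "0::real"]
  proof eventually_elim
    case (elim h)
    have "measure \<mu> A \<le> measure \<mu> (nbhd A h)"
      using subset_nbhd[OF elim] by (intro finite_measure_mono) (auto simp: sets_borel borel_open open_nbhd)
    then show ?case using elim by simp
  qed
qed

context
  fixes f :: "'a \<Rightarrow> real"
  assumes f: "f \<in> Lip"
begin

lemma f_meas: "f \<in> borel_measurable \<mu>"
  by (intro measurable_borel borel_measurable_Lip f)

lemma grad_meas: "grad_mod f \<in> borel_measurable \<mu>"
  by (intro measurable_borel borel_measurable_grad_mod f)

lemma open_superlevel: "open {x. y < f x}"
  by (intro open_Collect_less continuous_on_Lip[OF f] continuous_on_const)

lemma f_rearr_less: "0 < s \<Longrightarrow> s < 1 \<Longrightarrow> y < rearr \<mu> f s \<longleftrightarrow> s < measure \<mu> {x. y < f x}"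
  using less_rearr_iff[OF prob f_meas] by (simp add: space_UNIV)

lemma f_rearr_le: "0 < s \<Longrightarrow> s < 1 \<Longrightarrow> rearr \<mu> f s \<le> y \<longleftrightarrow> measure \<mu> {x. y < f x} \<le> s"
  using rearr_le_iff[OF prob f_meas] by (simp add: space_UNIV)

text \<open>At a level strictly between the two values the superlevel set has measure in
  \<open>(\<sigma>, s]\<close>, so its perimeter is at least \<open>J \<sigma>\<close> because
  \<open>J\<close> increases. The coarea inequality is applied on this open interval of
  levels.\<close>

lemma rearr_drop_le:
  assumes s: "0 < \<sigma>" "\<sigma> \<le> s" "s < 1/2"
  shows "ennreal (J \<sigma> * (rearr \<mu> f \<sigma> - rearr \<mu> f s))
    \<le> (\<integral>\<^sup>+x\<in>{x \<in> space \<mu>. rearr \<mu> f s < f x \<and> f x < rearr \<mu> f \<sigma>}. ennreal (grad_mod f x) \<partial>\<mu>)"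
proof -
  let ?S = "{rearr \<mu> f s<..<rearr \<mu> f \<sigma>}"
  have "rearr \<mu> f s \<le> rearr \<mu> f \<sigma>"
    using s by (intro rearr_antimono[OF prob f_meas]) auto
  then have "ennreal (J \<sigma> * (rearr \<mu> f \<sigma> - rearr \<mu> f s)) = (\<integral>\<^sup>+y\<in>?S. ennreal (J \<sigma>) \<partial>lborel)"
    using J_pos[of \<sigma>] s by (simp add: nn_integral_cmult_indicator ennreal_mult'')
  also have "\<dots> \<le> (\<integral>\<^sup>+x\<in>f -` ?S. ennreal (grad_mod f x) \<partial>\<mu>)"
  proof (rule coarea_open[OF prob sets_borel f])
    fix y assume y: "y \<in> ?S"
    have "\<sigma> < measure \<mu> {x. y < f x}" "measure \<mu> {x. y < f x} \<le> s"
      using y s f_rearr_less[of \<sigma> y] f_rearr_le[of s y] by auto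
    then have "J \<sigma> \<le> J (measure \<mu> {x. y < f x})" "ereal (J (measure \<mu> {x. y < f x})) \<le> perimeter \<mu> {x. y < f x}"
      using s by (auto intro!: J_mono J_le_perimeter open_superlevel)
    then show "ereal (J \<sigma>) \<le> perimeter \<mu> {x. y < f x}"
      using order_trans ereal_less_eq(3) by blast
  qed auto
  also have "\<dots> = (\<integral>\<^sup>+x\<in>{x \<in> space \<mu>. rearr \<mu> f s < f x \<and> f x < rearr \<mu> f \<sigma>}. ennreal (grad_mod f x) \<partial>\<mu>)"
    by (intro nn_integral_cong) (auto split: split_indicator)
  finally show ?thesis .
qed

text \<open>The excess integral equals the integral of the measures of \<open>{f > y}\<close> over
  the levels \<open>y > rearr \<mu> f s\<close>. These measures are at most \<open>s\<close>, so by
  concavity the perimeter is at least \<open>J s / s\<close> times the measure. The coarea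
  inequality leaves the gradient integrated over a set of measure at most \<open>s\<close>, and
  \<open>bathtub\<close> compares this with the rearranged gradient on \<open>(0,s)\<close>.\<close>

lemma nn_integral_excess_le:
  assumes s: "0 < s" "s < 1/2"
  shows "ennreal (J s / s) * (\<integral>\<^sup>+r\<in>{0<..<s}. ennreal (rearr \<mu> f r - rearr \<mu> f s) \<partial>leb01)
    \<le> (\<integral>\<^sup>+r\<in>{0<..<s}. ennreal (rearr \<mu> (grad_mod f) r) \<partial>leb01)"
proof -
  let ?c = "rearr \<mu> f s" and ?w = "grad_mod f"
  let ?m = "\<lambda>y. measure \<mu> {x. y < f x}"
  note [measurable] = f_meas grad_meas
  have fr[measurable]: "rearr \<mu> f \<in> borel_measurable leb01"
    by (rule borel_measurable_rearr[OF prob f_meas])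
  have gr[measurable]: "rearr \<mu> ?w \<in> borel_measurable leb01"
    by (rule borel_measurable_rearr[OF prob grad_meas])
  have m_le: "?m y \<le> s" if "?c < y" for y
    using f_rearr_le[of s y] that s by auto
  have m_mono: "mono (\<lambda>y. - ?m y)"
    by (intro monoI le_imp_neg_le finite_measure_mono) (auto simp: sets_borel borel_open open_superlevel)
  have m_meas[measurable]: "?m \<in> borel_measurable borel"
    using borel_measurable_mono[OF m_mono] borel_measurable_uminus_eq by blast
  have q: "ereal (J s / s * ?m y) \<le> perimeter \<mu> {x. y < f x}" if y: "?c < y" for y
  proof (cases "?m y = 0")
    case False
    then have pos: "0 < ?m y" using measure_nonneg[of \<mu>] by (simp add: less_le)
    have "J s / s * ?m y \<le> J (?m y)"
      using J_ratio[of "?m y" s] m_le[OF y] pos s by (simp add: field_simps)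
    also have "ereal (J (?m y)) \<le> perimeter \<mu> {x. y < f x}"
      using m_le[OF y] pos s by (intro J_le_perimeter open_superlevel) auto
    finally show ?thesis by simp
  qed (simp add: perimeter_nonneg open_superlevel zero_ereal_def[symmetric])
  have "(\<integral>\<^sup>+r\<in>{0<..<s}. ennreal (rearr \<mu> f r - ?c) \<partial>leb01) = (\<integral>\<^sup>+r. ennreal (rearr \<mu> f r - ?c) \<partial>leb01)"
  proof (intro nn_integral_cong)
    fix r assume r: "r \<in> space leb01"
    have "rearr \<mu> f r \<le> ?c" if "s \<le> r"
      using that r s by (intro rearr_antimono[OF prob f_meas]) auto
    then show "ennreal (rearr \<mu> f r - ?c) * indicator {0<..<s} r = ennreal (rearr \<mu> f r - ?c)"
      using r by (auto split: split_indicator simp: ennreal_neg)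
  qed
  also have "\<dots> = (\<integral>\<^sup>+x. ennreal (f x - ?c) \<partial>\<mu>)"
    by (rule nn_integral_rearr[OF prob f_meas, of "\<lambda>y. ennreal (y - ?c)"]) measurable
  also have "\<dots> = (\<integral>\<^sup>+x. emeasure lborel ({?c<..} \<inter> {?c..<f x}) \<partial>\<mu>)"
  proof (intro nn_integral_cong)
    fix x
    have "{?c<..} \<inter> {?c..<f x} = {?c<..<f x}" by auto
    then show "ennreal (f x - ?c) = emeasure lborel ({?c<..} \<inter> {?c..<f x})"
      by (cases "?c \<le> f x") (auto simp: ennreal_neg)
  qed
  also have "\<dots> = (\<integral>\<^sup>+y\<in>{?c<..}. emeasure \<mu> {x \<in> space \<mu>. ?c \<le> y \<and> y < f x} \<partial>lborel)"
    by (rule layer_cake[OF prob]) auto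
  also have "\<dots> = (\<integral>\<^sup>+y\<in>{?c<..}. ennreal (?m y) \<partial>lborel)"
    by (intro nn_integral_cong) (auto split: split_indicator simp: space_UNIV emeasure_eq_measure)
  finally have "ennreal (J s / s) * (\<integral>\<^sup>+r\<in>{0<..<s}. ennreal (rearr \<mu> f r - ?c) \<partial>leb01)
      = ennreal (J s / s) * (\<integral>\<^sup>+y\<in>{?c<..}. ennreal (?m y) \<partial>lborel)" by simp
  also have "\<dots> = (\<integral>\<^sup>+y\<in>{?c<..}. ennreal (J s / s * ?m y) \<partial>lborel)"
    using J_pos[of s] s
    by (subst nn_integral_cmult[symmetric]) (auto intro!: nn_integral_cong split: split_indicator simp flip: ennreal_mult)
  also have "\<dots> \<le> (\<integral>\<^sup>+x\<in>f -` {?c<..}. ennreal (?w x) \<partial>\<mu>)"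
    by (rule coarea_open[OF prob sets_borel f]) (use q in auto)
  also have "\<dots> = (\<integral>\<^sup>+x\<in>{x \<in> space \<mu>. ?c < f x}. ennreal (?w x) \<partial>\<mu>)"
    by (intro nn_integral_cong) (auto split: split_indicator)
  also have "\<dots> \<le> (\<integral>\<^sup>+r\<in>{0<..<s}. ennreal (rearr \<mu> ?w r) \<partial>leb01)"
  proof (rule bathtub[where A="space \<mu>" and B="space leb01" and c="ennreal (rearr \<mu> ?w s)"])
    show "{0<..<s} \<in> sets leb01"
      using s by (subst sets_restrict_space_iff) auto
    show "(\<integral>\<^sup>+x\<in>space \<mu>. (ennreal (?w x) - ennreal (rearr \<mu> ?w s)) \<partial>\<mu>) =
      (\<integral>\<^sup>+r\<in>space leb01. (ennreal (rearr \<mu> ?w r) - ennreal (rearr \<mu> ?w s)) \<partial>leb01)"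
    proof -
      have "(\<integral>\<^sup>+r\<in>space leb01. (ennreal (rearr \<mu> ?w r) - ennreal (rearr \<mu> ?w s)) \<partial>leb01)
          = (\<integral>\<^sup>+r. (ennreal (rearr \<mu> ?w r) - ennreal (rearr \<mu> ?w s)) \<partial>leb01)"
        by (intro nn_integral_cong) auto
      also have "\<dots> = (\<integral>\<^sup>+x. (ennreal (?w x) - ennreal (rearr \<mu> ?w s)) \<partial>\<mu>)"
        by (rule nn_integral_rearr[OF prob grad_meas]) measurable
      also have "\<dots> = (\<integral>\<^sup>+x\<in>space \<mu>. (ennreal (?w x) - ennreal (rearr \<mu> ?w s)) \<partial>\<mu>)"
        by (intro nn_integral_cong) auto
      finally show ?thesis ..
    qed
    have "emeasure leb01 {0<..<s} = ennreal s"
      using s by (subst emeasure_restrict_space) auto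
    moreover have "emeasure \<mu> {x \<in> space \<mu>. ?c < f x} \<le> ennreal s"
      using f_rearr_le[of s ?c] s by (auto simp: emeasure_eq_measure space_UNIV intro: ennreal_leI)
    ultimately show "emeasure \<mu> {x \<in> space \<mu>. ?c < f x} \<le> emeasure leb01 {0<..<s}" by simp
    fix r
    show "ennreal (rearr \<mu> ?w s) \<le> ennreal (rearr \<mu> ?w r)" if "r \<in> {0<..<s}"
      using that s by (intro ennreal_leI rearr_antimono[OF prob grad_meas]) auto
    show "ennreal (rearr \<mu> ?w r) \<le> ennreal (rearr \<mu> ?w s)" if "r \<in> space leb01 - {0<..<s}"
      using that s by (intro ennreal_leI rearr_antimono[OF prob grad_meas]) auto
  qed (use s in auto)
  finally show ?thesis .
qed

end

end

section \<open>Pointwise bounds by the Hardy operators\<close>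

context estimator
begin

context
  fixes f :: "'a \<Rightarrow> real"
  assumes f: "f \<in> Lip"
begin

lemma rearr_grad_bounds:
  obtains L where "0 \<le> L" "\<And>s. 0 < s \<Longrightarrow> s < 1 \<Longrightarrow> 0 \<le> rearr \<mu> (grad_mod f) s \<and> rearr \<mu> (grad_mod f) s \<le> L"
    "\<And>x. grad_mod f x \<le> L"
proof -
  obtain L where L: "0 \<le> L" "\<And>x y. \<bar>f x - f y\<bar> \<le> L * dist x y"
    using LipE[OF f] by blast
  note le = grad_mod_le_Lip[OF f L]
  have "0 \<le> rearr \<mu> (grad_mod f) s \<and> rearr \<mu> (grad_mod f) s \<le> L" if "0 < s" "s < 1" for s
  proof
    have *: "{x \<in> space \<mu>. L < grad_mod f x} = {}" using le by (auto simp: not_less)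
    then show "rearr \<mu> (grad_mod f) s \<le> L"
      unfolding rearr_le_iff[OF prob grad_meas[OF f] that] * using that by simp
    have "y < rearr \<mu> (grad_mod f) s" if "y < 0" for y
    proof -
      have "{x \<in> space \<mu>. y < grad_mod f x} = space \<mu>"
        using grad_mod_nonneg[of f] that by (auto intro: less_le_trans)
      then show ?thesis
        using \<open>s < 1\<close> by (subst less_rearr_iff[OF prob grad_meas[OF f] \<open>0 < s\<close>]) (auto simp: prob_space)
    qed
    then show "0 \<le> rearr \<mu> (grad_mod f) s"
      by (meson less_irrefl not_le)
  qed
  then show thesis using that L(1) le by blast
qed

text \<open>The difference is the mean over \<open>(0,s)\<close> of the excess of
  \<open>rearr \<mu> f\<close> over its value at \<open>s\<close>, so
  \<open>nn_integral_excess_le\<close> applies once Bochner integrability is known.\<close>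

lemma rearr_avg_excess_le:
  assumes s: "0 < s" "s < 1/2"
  shows "0 \<le> rearr_avg \<mu> f s - rearr \<mu> f s"
    and "rearr_avg \<mu> f s - rearr \<mu> f s \<le> s / J s * hardy_P (rearr \<mu> (grad_mod f)) s"
proof -
  let ?c = "rearr \<mu> f s" and ?w = "grad_mod f" and ?D = "{0<..<s}"
  obtain L where L: "0 \<le> L" "\<And>s. 0 < s \<Longrightarrow> s < 1 \<Longrightarrow> 0 \<le> rearr \<mu> (grad_mod f) s \<and> rearr \<mu> (grad_mod f) s \<le> L"
    using rearr_grad_bounds by metis
  note fr[measurable] = borel_measurable_rearr[OF prob f_meas[OF f]]
  note gr[measurable] = borel_measurable_rearr[OF prob grad_meas[OF f]]
  have D: "?D \<in> sets lebesgue" "?D \<subseteq> {0<..<1}" using s by auto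
  have Js: "0 < J s" using J_pos s by auto
  have w_fin: "(\<integral>\<^sup>+r\<in>?D. ennreal (rearr \<mu> ?w r) \<partial>leb01) < \<infinity>"
  proof -
    have "(\<integral>\<^sup>+r\<in>?D. ennreal (rearr \<mu> ?w r) \<partial>leb01) \<le> (\<integral>\<^sup>+r. ennreal L \<partial>leb01)"
      using L by (intro nn_integral_mono) (auto split: split_indicator intro: ennreal_leI)
    also have "\<dots> < \<infinity>"
      by (simp add: emeasure_restrict_space)
    finally show ?thesis .
  qed
  have w0: "0 \<le> rearr \<mu> ?w r" if "r \<in> ?D" for r using that s L(2)[of r] by auto
  have W: "ennreal (LINT r:?D|lebesgue. rearr \<mu> ?w r) = (\<integral>\<^sup>+r\<in>?D. ennreal (rearr \<mu> ?w r) \<partial>leb01)"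
    by (rule set_integral_leb01(2)[OF gr D w0 w_fin])
  note ex = nn_integral_excess_le[OF f s]
  \<comment> \<open>A Lipschitz function may be unbounded; integrability of its rearrangement near 0
    is itself a consequence of the excess estimate, the gradient being bounded.\<close>
  have x_fin: "(\<integral>\<^sup>+r\<in>?D. ennreal (rearr \<mu> f r - ?c) \<partial>leb01) < \<infinity>"
  proof (rule ccontr)
    assume "\<not> ?thesis"
    then have "ennreal (J s / s) * (\<integral>\<^sup>+r\<in>?D. ennreal (rearr \<mu> f r - ?c) \<partial>leb01) = \<infinity>"
      using Js s by (simp add: not_less top_unique ennreal_mult_top)
    then show False using ex w_fin by (simp add: top_unique)
  qed
  have x0: "0 \<le> rearr \<mu> f r - ?c" if "r \<in> ?D" for r
    using that s rearr_antimono[OF prob f_meas[OF f], of r s] by auto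
  have xm: "(\<lambda>r. rearr \<mu> f r - ?c) \<in> borel_measurable leb01" by measurable
  note X = set_integral_leb01[OF xm D x0 x_fin]
  let ?X = "LINT r:?D|lebesgue. (rearr \<mu> f r - ?c)" and ?W = "LINT r:?D|lebesgue. rearr \<mu> ?w r"
  have X0: "0 \<le> ?X" unfolding set_lebesgue_integral_def
    using x0 by (intro Bochner_Integration.integral_nonneg) (auto split: split_indicator)
  have W0: "0 \<le> ?W" unfolding set_lebesgue_integral_def
    using w0 by (intro Bochner_Integration.integral_nonneg) (auto split: split_indicator)
  have ci: "set_integrable lebesgue ?D (\<lambda>_. ?c)"
    using s by (simp add: set_integrable_def)
  have "(LINT r:?D|lebesgue. rearr \<mu> f r) = (LINT r:?D|lebesgue. ((rearr \<mu> f r - ?c) + ?c))" by simp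
  also have "\<dots> = ?X + (LINT r:?D|lebesgue. ?c)"
    by (rule set_integral_add(2)[OF X(1) ci])
  also have "(LINT r:?D|lebesgue. ?c) = ?c * s"
    using s by (simp add: set_lebesgue_integral_def)
  finally have avg: "rearr_avg \<mu> f s - ?c = ?X / s"
    using s by (simp add: rearr_avg_def hardy_P_def field_simps)
  then show "0 \<le> rearr_avg \<mu> f s - ?c" using X0 s by simp
  have "ennreal (J s / s * ?X) \<le> ennreal ?W"
    using ex X0 Js s unfolding W[symmetric] by (subst ennreal_mult) (simp_all only: X(2), auto)
  then have "J s / s * ?X \<le> ?W" using W0 by simp
  then have "?X / s \<le> ?W / J s"
    using Js s by (simp add: field_simps)
  also have "\<dots> = s / J s * hardy_P (rearr \<mu> ?w) s"
    using s by (simp add: hardy_P_def)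
  finally show "rearr_avg \<mu> f s - ?c \<le> s / J s * hardy_P (rearr \<mu> (grad_mod f)) s"
    unfolding avg .
qed

text \<open>Levels are taken at the points \<open>S i = t / \<theta> ^ i\<close>. In slice
  \<open>i\<close> only points \<open>r \<le> S i\<close> occur, where
  \<open>h r \<le> S i * (h r / r)\<close>, and the perimeters are at least
  \<open>J \<sigma>\<close> with \<open>\<sigma> \<ge> S i / \<theta>\<close>; so
  \<open>S i / J \<sigma>\<close> is at most \<open>\<theta>\<close> times \<open>t / J t\<close>.
  Adding the slices produces the kernel \<open>1 / r\<close> of the operator.\<close>

lemma oscillation_le_hardy_Q:
  assumes \<theta>: "1 < \<theta>" and t: "0 < t" "t < 1/2"
  obtains h where "h \<in> borel_measurable leb01" "\<And>s. 0 \<le> h s" "rearr leb01 h = rearr \<mu> (grad_mod f)"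
    "\<And>s. t / \<theta> ^ n \<le> s \<Longrightarrow> s < t \<Longrightarrow> rearr \<mu> f s - rearr \<mu> f t \<le> \<theta> * (t / J t) * hardy_Q h s"
proof -
  let ?w = "grad_mod f"
  define S where "S i = t / \<theta> ^ i" for i
  have S: "0 < S i" "S i \<le> t" for i
    using \<theta> t by (auto simp: S_def divide_le_eq)
  have S_Suc: "S i = \<theta> * S (Suc i)" for i
    using \<theta> by (simp add: S_def)
  have S_dec: "S (Suc i) \<le> S i" for i
    using S_Suc[of i] S(1)[of "Suc i"] \<theta> by simp
  have S1: "S i < 1/2" for i using S(2)[of i] t by simp
  define a where "a i = rearr \<mu> f (S i)" for i
  define e where "e i = measure \<mu> {x \<in> space \<mu>. a i < f x}" for i
  have e_eq: "e i = measure \<mu> {x. a i < f x}" for i by (simp add: e_def space_UNIV)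
  have a_mono: "mono a"
    unfolding a_def using S S_dec less_trans[OF S1]
    by (intro incseq_SucI rearr_antimono[OF prob f_meas[OF f]]) auto
  \<comment> \<open>The inequality can be strict if \<open>f\<close> has a level set of positive
    measure; hence the slices of the unit interval are delimited by \<open>e i\<close> and not by
    \<open>S i\<close>.\<close>
  have e_le: "e i \<le> S i" for i
    using f_rearr_le[OF f S(1)[of i], of "a i"] S1[of i] by (simp add: e_eq a_def)
  obtain h where h[measurable]: "h \<in> borel_measurable leb01" and h0: "\<And>s. 0 \<le> h s"
    and hr: "rearr leb01 h = rearr \<mu> ?w"
    and hint: "(\<integral>\<^sup>+s. ennreal (h s) \<partial>leb01) = (\<integral>\<^sup>+x. ennreal (?w x) \<partial>\<mu>)"
    and hlayer: "\<And>i b s. \<lbrakk>i < n; b \<le> a (Suc i); e (Suc i) \<le> s; s \<le> measure \<mu> {x \<in> space \<mu>. b \<le> f x}\<rbrakk> \<Longrightarrow>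
      (\<integral>\<^sup>+x\<in>{x \<in> space \<mu>. a i < f x \<and> f x < b}. ennreal (?w x) \<partial>\<mu>) \<le> (\<integral>\<^sup>+r\<in>{s..<e i}. ennreal (h r) \<partial>leb01)"
    by (rule layered_rearrangement[OF prob f_meas[OF f] grad_meas[OF f] grad_mod_nonneg a_mono, of n, folded e_def])
      (rule that; assumption)
  define H where "H A = (\<integral>\<^sup>+r\<in>A. ennreal (h r / r) \<partial>leb01)" for A
  let ?K = "ennreal (\<theta> * (t / J t))"
  have hm: "(\<lambda>r. h r / r) \<in> borel_measurable leb01"
    by (rule borel_measurable_divide[OF h measurable_leb01]) simp
  then have [measurable]: "(\<lambda>r. ennreal (h r / r)) \<in> borel_measurable leb01"
    by (rule measurable_compose) simp
  have ind[measurable]: "(indicator {x..<y} :: real \<Rightarrow> ennreal) \<in> borel_measurable leb01" for x y :: real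
    by (rule measurable_leb01) auto
  have H_split: "H {x..<y} + H {y..<1} \<le> H {x..<1}" if "x \<le> y" "y \<le> 1" for x y
  proof -
    have "H {x..<y} + H {y..<1} = (\<integral>\<^sup>+r. ennreal (h r / r) * indicator {x..<y} r + ennreal (h r / r) * indicator {y..<1} r \<partial>leb01)"
      unfolding H_def by (intro nn_integral_add[symmetric]) measurable
    also have "\<dots> \<le> H {x..<1}"
      unfolding H_def using that by (intro nn_integral_mono) (auto split: split_indicator)
    finally show ?thesis .
  qed
  \<comment> \<open>One slice, possibly cut off from above at the level \<open>b\<close>. The point
    \<open>\<sigma>\<close> controls the perimeter and \<open>s\<close> the left end of the
    interval; they may differ where \<open>rearr \<mu> f\<close> is constant between them.\<close>
  have step: "ennreal (b - a i) \<le> ?K * H {s..<e i}"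
    if i: "i < n" and \<sigma>: "S (Suc i) \<le> \<sigma>" "\<sigma> \<le> S i" and b: "b = rearr \<mu> f \<sigma>" "b \<le> a (Suc i)"
      and s: "e (Suc i) \<le> s" "s \<le> measure \<mu> {x. b \<le> f x}" for i b \<sigma> s
  proof -
    have \<sigma>0: "0 < \<sigma>" "\<sigma> < 1/2" using \<sigma> S(1)[of "Suc i"] S1[of i] by auto
    have J\<sigma>: "0 < J \<sigma>" "0 < J t" using J_pos \<sigma>0 t by auto
    have "ennreal (J \<sigma> * (b - a i)) \<le> (\<integral>\<^sup>+x\<in>{x \<in> space \<mu>. a i < f x \<and> f x < b}. ennreal (?w x) \<partial>\<mu>)"
      using rearr_drop_le[OF f \<sigma>0(1) \<sigma>(2) S1] by (simp add: b(1) a_def)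
    also have "\<dots> \<le> (\<integral>\<^sup>+r\<in>{s..<e i}. ennreal (h r) \<partial>leb01)"
      using s by (intro hlayer i b(2)) (auto simp: space_UNIV)
    also have "\<dots> \<le> (\<integral>\<^sup>+r. ennreal (S i) * (ennreal (h r / r) * indicator {s..<e i} r) \<partial>leb01)"
    proof (intro nn_integral_mono)
      fix r assume "r \<in> space leb01"
      then have r: "0 < r" "r < 1" by auto
      show "ennreal (h r) * indicator {s..<e i} r \<le> ennreal (S i) * (ennreal (h r / r) * indicator {s..<e i} r)"
      proof (cases "r \<in> {s..<e i}")
        case True
        then have "r \<le> S i" using e_le[of i] by simp
        then have "h r \<le> S i * (h r / r)"
          using r h0[of r] by (simp add: pos_le_divide_eq mult.commute mult_right_mono)
        then show ?thesis
          using True S(1)[of i] r h0[of r] by (simp add: ennreal_mult[symmetric] ennreal_leI)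
      qed simp
    qed
    also have "\<dots> = ennreal (S i) * H {s..<e i}"
      unfolding H_def by (intro nn_integral_cmult) measurable
    finally have *: "ennreal (J \<sigma> * (b - a i)) \<le> ennreal (S i) * H {s..<e i}" .
    have "ennreal (b - a i) = ennreal (1 / J \<sigma>) * ennreal (J \<sigma> * (b - a i))"
      using J\<sigma> by (simp add: ennreal_mult'[symmetric])
    also have "\<dots> \<le> ennreal (1 / J \<sigma>) * (ennreal (S i) * H {s..<e i})"
      by (intro mult_left_mono *) simp
    also have "\<dots> = ennreal (S i / J \<sigma>) * H {s..<e i}"
      using J\<sigma> S(1)[of i] by (simp add: mult.assoc[symmetric] ennreal_mult[symmetric])
    also have "\<dots> \<le> ?K * H {s..<e i}"
    proof (intro mult_right_mono ennreal_leI)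
      have "S i / J \<sigma> \<le> \<theta> * (\<sigma> / J \<sigma>)"
        unfolding S_Suc[of i] using \<sigma> \<theta> J\<sigma> by (simp add: divide_right_mono mult_left_mono)
      also have "\<dots> \<le> \<theta> * (t / J t)"
        using ratio_mono[of \<sigma> t] \<sigma>0 \<sigma>(2) S(2)[of i] t \<theta> by (intro mult_left_mono) auto
      finally show "S i / J \<sigma> \<le> \<theta> * (t / J t)" .
    qed simp
    finally show ?thesis .
  qed
  have e_Suc: "e (Suc i) \<le> e i" for i
    unfolding e_eq using monoD[OF a_mono, of i "Suc i"]
    by (intro finite_measure_mono) (auto simp: sets_borel borel_open open_superlevel[OF f] intro: le_less_trans)
  have e1: "e i \<le> 1" for i by (simp add: e_eq)
  \<comment> \<open>Telescoping over complete slices, whose intervals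
    \<open>{e (Suc i)..<e i}\<close> are disjoint.\<close>
  have full: "ennreal (a i - a 0) \<le> ?K * H {e i..<1}" if "i \<le> n" for i
    using that
  proof (induction i)
    case (Suc i)
    have "measure \<mu> {x. a (Suc i) < f x} \<le> measure \<mu> {x. a (Suc i) \<le> f x}"
      by (intro finite_measure_mono)
        (auto simp: sets_borel intro!: borel_closed closed_Collect_le continuous_on_Lip[OF f] continuous_on_const)
    then have st: "ennreal (a (Suc i) - a i) \<le> ?K * H {e (Suc i)..<e i}"
      using Suc.prems S_dec[of i] by (intro step[of i "S (Suc i)"]) (auto simp: a_def e_eq)
    have "ennreal (a (Suc i) - a 0) = ennreal (a (Suc i) - a i) + ennreal (a i - a 0)"
      using monoD[OF a_mono] by (subst ennreal_plus[symmetric]) auto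
    also have "\<dots> \<le> ?K * H {e (Suc i)..<e i} + ?K * H {e i..<1}"
      using Suc by (intro add_mono st) auto
    also have "\<dots> \<le> ?K * H {e (Suc i)..<1}"
      unfolding distrib_left[symmetric] by (intro mult_left_mono H_split e_Suc e1) simp
    finally show ?case .
  qed simp
  have main: "ennreal (rearr \<mu> f s - rearr \<mu> f t) \<le> ?K * H {s..<1}" if s: "t / \<theta> ^ n \<le> s" "s < t" for s
  proof -
    let ?b = "rearr \<mu> f s"
    have a0: "a 0 = rearr \<mu> f t" by (simp add: a_def S_def)
    have s0: "0 < s" "s < 1/2" using s S(1)[of n] t by (auto simp: S_def)
    have bn: "?b \<le> a n"
      unfolding a_def using s S(1)[of n] s0 by (intro rearr_antimono[OF prob f_meas[OF f]]) (auto simp: S_def)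
    show ?thesis
    proof (cases "?b \<le> a 0")
      case False
      \<comment> \<open>The first level at or above \<open>?b\<close>: the slice just below it is
        cut off at \<open>?b\<close>, the slices further down are complete.\<close>
      define m where "m = (LEAST i. ?b \<le> a i)"
      have m: "?b \<le> a m" unfolding m_def by (rule LeastI, rule bn)
      have "m \<le> n" unfolding m_def by (rule Least_le, rule bn)
      obtain j where j: "m = Suc j" using m False by (cases m) auto
      have "j < n" using \<open>m \<le> n\<close> j by simp
      have aj: "a j < ?b"
        using not_less_Least[of j "\<lambda>i. ?b \<le> a i"] j by (auto simp: m_def[symmetric])
      text \<open>If \<open>s < S (Suc j)\<close>, then \<open>f\<^sup>*\<close> is constant on \<open>[s, S (Suc j)]\<close>.\<close>
      define \<sigma> where "\<sigma> = max s (S (Suc j))"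
      have "s < e j"
        using f_rearr_less[OF f s0(1), of "a j"] s0 aj by (simp add: e_eq)
      then have sj: "s < S j" using e_le[of j] by simp
      have b: "?b = rearr \<mu> f \<sigma>"
      proof (cases "s \<le> S (Suc j)")
        case True
        then have "a (Suc j) \<le> ?b"
          unfolding a_def using s0 S1[of "Suc j"] by (intro rearr_antimono[OF prob f_meas[OF f]]) auto
        then show ?thesis using m j True by (simp add: \<sigma>_def a_def max_def)
      qed (simp add: \<sigma>_def max_def)
      have "ennreal (?b - a j) \<le> ?K * H {s..<e j}"
      proof (rule step[OF \<open>j < n\<close> _ _ b])
        show "S (Suc j) \<le> \<sigma>" "\<sigma> \<le> S j" using sj S_dec[of j] by (auto simp: \<sigma>_def)
        show "?b \<le> a (Suc j)" using m j by simp
        then show "e (Suc j) \<le> s"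
          using f_rearr_le[OF f s0(1), of "a (Suc j)"] s0 by (simp add: e_eq)
        show "s \<le> measure \<mu> {x. ?b \<le> f x}"
          using rearr_superlevel_ge[OF prob f_meas[OF f] s0(1)] s0 by (simp add: space_UNIV)
      qed
      moreover have "ennreal (?b - rearr \<mu> f t) = ennreal (?b - a j) + ennreal (a j - a 0)"
        using aj monoD[OF a_mono, of 0 j] by (subst ennreal_plus[symmetric]) (auto simp: a0)
      ultimately have "ennreal (?b - rearr \<mu> f t) \<le> ?K * H {s..<e j} + ?K * H {e j..<1}"
        using full[of j] \<open>j < n\<close> by (simp add: add_mono)
      also have "\<dots> \<le> ?K * H {s..<1}"
        unfolding distrib_left[symmetric] using \<open>s < e j\<close> by (intro mult_left_mono H_split e1) auto
      finally show ?thesis .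
    qed (simp add: a0 ennreal_neg)
  qed
  obtain L where L: "0 \<le> L" "\<And>x. ?w x \<le> L" using rearr_grad_bounds by metis
  have "rearr \<mu> f s - rearr \<mu> f t \<le> \<theta> * (t / J t) * hardy_Q h s" if s: "t / \<theta> ^ n \<le> s" "s < t" for s
  proof -
    have s0: "0 < s" "s < 1" using s S(1)[of n] t by (auto simp: S_def)
    have H_open: "H {s..<1} = H {s<..<1}"
    proof -
      have "AE r in lebesgue. r \<noteq> s" by (rule AE_completion) (rule AE_lborel_singleton)
      then have "AE r in leb01. r \<noteq> s" by (subst AE_restrict_space_iff) auto
      then show ?thesis unfolding H_def
        by (intro nn_integral_cong_AE) (auto split: split_indicator)
    qed
    \<comment> \<open>Finiteness makes \<open>hardy_Q h s\<close> a genuine integral: beyond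
      \<open>s\<close> the kernel is at most \<open>1 / s\<close>, and \<open>h\<close> has the same
      integral as the bounded gradient.\<close>
    have "H {s<..<1} \<le> (\<integral>\<^sup>+r. ennreal (1 / s) * ennreal (h r) \<partial>leb01)"
      unfolding H_def
    proof (intro nn_integral_mono)
      fix r assume "r \<in> space leb01"
      show "ennreal (h r / r) * indicator {s<..<1} r \<le> ennreal (1 / s) * ennreal (h r)"
        using s0 h0[of r] by (auto split: split_indicator simp: ennreal_mult[symmetric] intro!: ennreal_leI frac_le)
    qed
    also have "\<dots> = ennreal (1 / s) * (\<integral>\<^sup>+x. ennreal (?w x) \<partial>\<mu>)"
      by (simp add: nn_integral_cmult hint)
    also have "\<dots> \<le> ennreal (1 / s) * (\<integral>\<^sup>+x. ennreal L \<partial>\<mu>)"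
      by (intro mult_left_mono nn_integral_mono ennreal_leI L) simp
    also have "\<dots> < \<infinity>" by (simp add: emeasure_space_1 ennreal_mult_less_top)
    finally have fin: "(\<integral>\<^sup>+r\<in>{s<..<1}. ennreal (h r / r) \<partial>leb01) < \<infinity>" by (simp add: H_def)
    have "ennreal (hardy_Q h s) = H {s..<1}"
      unfolding H_open hardy_Q_def unfolding H_def
      using s0 h0 by (intro set_integral_leb01(2)[OF hm _ _ _ fin]) auto
    then have "ennreal (rearr \<mu> f s - rearr \<mu> f t) \<le> ?K * ennreal (hardy_Q h s)"
      using main[OF s] by simp
    also have "\<dots> = ennreal (\<theta> * (t / J t) * hardy_Q h s)"
      using \<theta> t J_pos[of t] by (intro ennreal_mult'[symmetric]) simp
    finally show ?thesis
    proof -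
      assume le: "ennreal (rearr \<mu> f s - rearr \<mu> f t) \<le> ennreal (\<theta> * (t / J t) * hardy_Q h s)"
      have "0 \<le> hardy_Q h s"
        unfolding hardy_Q_def set_lebesgue_integral_def
        using s0 h0 by (intro Bochner_Integration.integral_nonneg) (auto split: split_indicator)
      then have "0 \<le> \<theta> * (t / J t) * hardy_Q h s" using \<theta> t J_pos[of t] by simp
      then show ?thesis using le by (simp add: ennreal_le_iff)
    qed
  qed
  then show thesis using that h h0 hr by blast
qed

end

end

subsection \<open>Norm estimates\<close>

lemma
  assumes "banach_function_norm \<rho>"
  shows bfn_mult: "\<And>F a. F \<in> borel_measurable leb01 \<Longrightarrow> 0 \<le> a \<Longrightarrow> \<rho> (\<lambda>x. ennreal a * F x) = ennreal a * \<rho> F"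
    and bfn_mono: "\<And>F H. F \<in> borel_measurable leb01 \<Longrightarrow> H \<in> borel_measurable leb01 \<Longrightarrow>
      (AE x in leb01. F x \<le> H x) \<Longrightarrow> \<rho> F \<le> \<rho> H"
    and bfn_SUP: "\<And>Fn F. F \<in> borel_measurable leb01 \<Longrightarrow> (\<And>n::nat. Fn n \<in> borel_measurable leb01) \<Longrightarrow>
      (AE x in leb01. incseq (\<lambda>n. Fn n x) \<and> F x = (SUP n. Fn n x)) \<Longrightarrow> \<rho> F = (SUP n. \<rho> (Fn n))"
    and bfn_indicator: "\<And>E. E \<in> sets leb01 \<Longrightarrow> \<rho> (indicator E) < \<infinity>"
  using assms unfolding banach_function_norm_def by blast+

lemma bfs_norm_mult:
  assumes "banach_function_norm \<rho>" "f \<in> borel_measurable leb01" "0 \<le> a"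
  shows "bfs_norm \<rho> (\<lambda>x. a * f x) = ennreal a * bfs_norm \<rho> f"
  unfolding bfs_norm_def using bfn_mult[OF assms(1), of "\<lambda>x. ennreal \<bar>f x\<bar>" a] assms(2,3)
  by (simp add: abs_mult ennreal_mult)

lemma bfs_norm_mono:
  assumes "banach_function_norm \<rho>" "f \<in> borel_measurable leb01" "g \<in> borel_measurable leb01"
    and "\<And>x. 0 < x \<Longrightarrow> x < 1 \<Longrightarrow> \<bar>f x\<bar> \<le> \<bar>g x\<bar>"
  shows "bfs_norm \<rho> f \<le> bfs_norm \<rho> g"
  unfolding bfs_norm_def using assms(2-)
  by (intro bfn_mono[OF assms(1)]) (auto intro!: AE_I2 ennreal_leI)

text \<open>Normalization reduces to the unit ball over which \<open>op_norm\<close> is a supremum.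
  A function of norm 0 cannot be normalized; there \<open>bounded_on\<close> gives norm 0 for its
  image.\<close>

lemma op_norm_bound:
  assumes \<rho>: "banach_function_norm \<rho>" and T: "bounded_on \<rho> T"
    and hom: "\<And>a f. T (\<lambda>x. a * f x) = (\<lambda>x. a * T f x)"
    and f: "f \<in> bfs_space \<rho>"
  shows "bfs_norm \<rho> (T f) \<le> op_norm \<rho> T * bfs_norm \<rho> f"
proof -
  have Tf: "T f \<in> bfs_space \<rho>" using T f by (auto simp: bounded_on_def)
  obtain \<nu> where \<nu>: "bfs_norm \<rho> f = ennreal \<nu>" "0 \<le> \<nu>"
    using f by (cases "bfs_norm \<rho> f") (auto simp: bfs_space_def)
  show ?thesis
  proof (cases "\<nu> = 0")
    case True
    obtain C where "bfs_norm \<rho> (T f) \<le> ennreal C * bfs_norm \<rho> f"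
      using T f by (auto simp: bounded_on_def)
    then show ?thesis by (simp add: \<nu>(1) True)
  next
    case False
    define g where "g x = 1 / \<nu> * f x" for x
    have fm: "f \<in> borel_measurable leb01" using f by (simp add: bfs_space_def)
    have gn: "bfs_norm \<rho> g = 1"
      unfolding g_def using bfs_norm_mult[OF \<rho> fm, of "1 / \<nu>"] \<nu> False
      by (simp add: ennreal_mult[symmetric])
    have g: "g \<in> bfs_space \<rho>"
      using gn borel_measurable_times[OF borel_measurable_const fm, of "1 / \<nu>"]
      by (simp add: bfs_space_def g_def[abs_def])
    have Tg: "T g \<in> borel_measurable leb01" using T g by (auto simp: bounded_on_def bfs_space_def)
    have "f = (\<lambda>x. \<nu> * g x)" using False by (auto simp: g_def)
    then have "bfs_norm \<rho> (T f) = bfs_norm \<rho> (\<lambda>x. \<nu> * T g x)" by (metis hom)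
    also have "\<dots> = ennreal \<nu> * bfs_norm \<rho> (T g)" by (rule bfs_norm_mult[OF \<rho> Tg \<nu>(2)])
    also have "\<dots> \<le> ennreal \<nu> * op_norm \<rho> T"
      unfolding op_norm_def using g gn by (intro mult_left_mono SUP_upper) auto
    finally show ?thesis by (simp add: \<nu>(1) mult.commute)
  qed
qed

lemma hardy_P_scale: "hardy_P (\<lambda>x. a * f x) = (\<lambda>x. a * hardy_P f x)"
  by (simp add: hardy_P_def fun_eq_iff)

lemma hardy_Q_scale: "hardy_Q (\<lambda>x. a * f x) = (\<lambda>x. a * hardy_Q f x)"
  by (simp add: hardy_Q_def fun_eq_iff flip: times_divide_eq_right)

text \<open>The rearrangement of \<open>f\<close> is not known to lie in the space, so boundedness
  of the operator does not provide this measurability. Superlevel sets of a rearrangement are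
  intervals; hence its extension by 0 is Borel, and its integral over \<open>(0,s)\<close> depends
  measurably on \<open>s\<close>.\<close>

lemma borel_measurable_hardy_P_rearr:
  assumes M: "prob_space M" and u: "u \<in> borel_measurable M"
  shows "hardy_P (rearr M u) \<in> borel_measurable leb01"
proof -
  let ?v = "\<lambda>r. indicator {0<..<1} r * rearr M u r"
  have v[measurable]: "?v \<in> borel_measurable borel"
  proof (subst borel_measurable_iff_greater, intro allI)
    fix y
    let ?m = "measure M {x \<in> space M. y < u x}"
    have "{r \<in> space borel. y < ?v r} = {0<..<?m} \<union> (if y < 0 then - {0<..<1} else {})"
      using rearr_superlevel[OF M u, of y] prob_space.prob_le_1[OF M, of "{x \<in> space M. y < u x}"]
      by (auto simp: set_eq_iff indicator_def split: if_splits)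
    then show "{r \<in> space borel. y < ?v r} \<in> sets borel" by simp
  qed
  define g where "g s = (\<integral>r. indicator {0<..<s} r * ?v r \<partial>lborel)" for s :: real
  have "(\<lambda>s. \<integral>r. (if 0 < r \<and> r < s then ?v r else 0) \<partial>lborel) \<in> borel_measurable borel"
    by (intro lborel.borel_measurable_lebesgue_integral) measurable
  also have "(\<lambda>s. \<integral>r. (if 0 < r \<and> r < s then ?v r else 0) \<partial>lborel) = g"
    unfolding g_def by (intro ext Bochner_Integration.integral_cong) (auto simp: indicator_def)
  finally have g: "(\<lambda>s. (1 / s) * g s) \<in> borel_measurable leb01"
    by (intro measurable_leb01) measurable
  have eq: "hardy_P (rearr M u) s = (1 / s) * g s" if "s \<in> space leb01" for s
  proof -
    have "(LINT r:{0<..<s}|lebesgue. rearr M u r) = (\<integral>r. indicator {0<..<s} r * ?v r \<partial>lebesgue)"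
      unfolding set_lebesgue_integral_def using that
      by (intro Bochner_Integration.integral_cong) (auto simp: indicator_def)
    also have "\<dots> = g s"
      unfolding g_def by (intro integral_completion) measurable
    finally show ?thesis by (simp add: hardy_P_def)
  qed
  show ?thesis by (subst measurable_cong[OF eq]) (simp_all only: g)
qed

text \<open>A zero in \<open>(0,1/2)\<close> spreads to the left by monotonicity and to the right
  because \<open>J s / s\<close> decreases. Then \<open>J\<close> vanishes on the whole interval,
  and as \<open>t / 0\<close> is infinite in \<open>ennreal\<close> and \<open>G\<close> is
  positive, so is the weight integral.\<close>

lemma isop_estimator_pos:
  assumes est: "isop_estimator \<mu> J" and G: "\<forall>t\<in>{0<..<1/2}. 0 < G t"
    and fin: "weight_integral J G < \<infinity>" and t: "0 < t" "t < 1/2"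
  shows "0 < J t"
proof (rule ccontr)
  assume "\<not> 0 < J t"
  obtain \<phi> where \<phi>: "profile_shape \<phi>" "\<And>t. t \<in> {0..1/2} \<Longrightarrow> J t = \<phi> t" "\<And>t. t \<in> {0..1/2} \<Longrightarrow> 0 \<le> \<phi> t"
    using est unfolding isop_estimator_def by force
  then have Jt: "\<phi> t = 0" using \<open>\<not> 0 < J t\<close> t by (auto simp: not_less intro: antisym)
  have zero: "J s = 0" if s: "0 < s" "s < 1/2" for s
  proof -
    have "\<phi> s \<le> 0"
    proof (cases "s \<le> t")
      case True
      then show ?thesis using profile_shapeD(1)[OF \<phi>(1,3), of s t] s t Jt by auto
    next
      case False
      then have "\<phi> s * t \<le> \<phi> t * s" using profile_shapeD(2)[OF \<phi>(1,3), of t s] s t by auto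
      then show ?thesis using Jt t by (simp add: mult_le_0_iff)
    qed
    then show ?thesis using \<phi>(2,3)[of s] s by auto
  qed
  have "weight_integral J G = (\<integral>\<^sup>+t. \<infinity> \<partial>lebesgue_on {0<..<1/2::real})"
    unfolding weight_integral_def
  proof (intro nn_integral_cong)
    fix t :: real assume "t \<in> space (lebesgue_on {0<..<1/2})"
    then have t: "0 < t" "t < 1/2" by auto
    moreover have "0 < ennreal (G t)" using G t by simp
    ultimately show "ennreal t / ennreal (J t) * ennreal (G t) = \<infinity>"
      by (simp add: zero ennreal_divide_zero ennreal_top_mult less_le)
  qed
  also have "\<dots> = \<infinity>"
    by (simp add: emeasure_restrict_space ennreal_top_mult)
  finally show False using fin by simp
qed

lemma ennreal_le_of_scaled_le:
  assumes "\<And>\<theta>. 1 < \<theta> \<Longrightarrow> x \<le> ennreal \<theta> * y"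
  shows "x \<le> y"
proof -
  have "(\<lambda>n. ennreal (1 + 1 / real (Suc n)) * y) \<longlonglongrightarrow> ennreal (1 + 0) * y"
    by (intro tendsto_mult_ennreal tendsto_ennrealI tendsto_intros LIMSEQ_Suc[OF lim_1_over_n]) auto
  then have "(\<lambda>n. ennreal (1 + 1 / real (Suc n)) * y) \<longlonglongrightarrow> y" by simp
  then show ?thesis
    by (rule LIMSEQ_le_const) (intro exI allI impI assms, simp)
qed

section \<open>Norm bounds for a fixed Lipschitz function\<close>

context estimator
begin

context
  fixes f :: "'a \<Rightarrow> real" and \<rho>
  assumes f: "f \<in> Lip" and ri: "ri_norm \<rho>"
begin

lemma bfn: "banach_function_norm \<rho>"
  using ri by (simp add: ri_norm_def)

lemma rearr_f_meas: "rearr \<mu> f \<in> borel_measurable leb01"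
  by (rule borel_measurable_rearr[OF prob f_meas[OF f]])

text \<open>A Lipschitz constant bounds the gradient, and bounded functions have finite norm because
  indicators do.\<close>

lemma rearr_grad_in_space: "rearr \<mu> (grad_mod f) \<in> bfs_space \<rho>"
proof -
  obtain L where L: "0 \<le> L" "\<And>s. 0 < s \<Longrightarrow> s < 1 \<Longrightarrow> 0 \<le> rearr \<mu> (grad_mod f) s \<and> rearr \<mu> (grad_mod f) s \<le> L"
    using rearr_grad_bounds[OF f] by metis
  have m: "rearr \<mu> (grad_mod f) \<in> borel_measurable leb01"
    by (rule borel_measurable_rearr[OF prob grad_meas[OF f]])
  let ?I = "indicator {0<..<1} :: real \<Rightarrow> ennreal"
  have I: "{0<..<1} \<in> sets leb01" by (subst sets_restrict_space_iff) auto
  have Im: "?I \<in> borel_measurable leb01" by (rule borel_measurable_indicator[OF I])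
  have "bfs_norm \<rho> (rearr \<mu> (grad_mod f)) \<le> \<rho> (\<lambda>x. ennreal L * ?I x)"
    unfolding bfs_norm_def
  proof (intro bfn_mono[OF bfn] AE_I2)
    show "ennreal \<bar>rearr \<mu> (grad_mod f) x\<bar> \<le> ennreal L * ?I x" if "x \<in> space leb01" for x
      using that L(2)[of x] by (simp add: ennreal_leI)
  qed (use m Im in measurable)
  also have "\<dots> = ennreal L * \<rho> ?I"
    by (rule bfn_mult[OF bfn Im L(1)])
  also have "\<dots> < \<infinity>" using bfn_indicator[OF bfn I] by (simp add: ennreal_mult_less_top)
  finally show ?thesis using m by (simp add: bfs_space_def)
qed

text \<open>The invariance axiom compares rearrangements of absolute values; rearranging the
  rearranged gradient once more changes nothing, as the laws agree.\<close>

lemma norm_eq_of_rearr_eq: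
  assumes h: "h \<in> borel_measurable leb01" "\<And>s. 0 \<le> h s" "rearr leb01 h = rearr \<mu> (grad_mod f)"
  shows "h \<in> bfs_space \<rho>" "bfs_norm \<rho> h = bfs_norm \<rho> (rearr \<mu> (grad_mod f))"
proof -
  have "rearr leb01 (\<lambda>s. \<bar>rearr \<mu> (grad_mod f) s\<bar>) = rearr \<mu> (\<lambda>x. \<bar>grad_mod f x\<bar>)"
    by (rule rearr_comp_rearr[OF prob grad_meas[OF f]]) simp
  then have "rearr leb01 (\<lambda>x. \<bar>h x\<bar>) = rearr leb01 (\<lambda>s. \<bar>rearr \<mu> (grad_mod f) s\<bar>)"
    using h by (simp add: grad_mod_nonneg)
  then show "h \<in> bfs_space \<rho>" "bfs_norm \<rho> h = bfs_norm \<rho> (rearr \<mu> (grad_mod f))"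
    using ri h(1) rearr_grad_in_space unfolding ri_norm_def by metis+
qed

lemma norm_osc_Q_le:
  assumes Q: "bounded_on \<rho> hardy_Q" and t: "0 < t" "t < 1/2"
  shows "bfs_norm \<rho> (\<lambda>s. (rearr \<mu> f s - rearr \<mu> f t) * indicator {0..<t} s)
    \<le> op_norm \<rho> hardy_Q * bfs_norm \<rho> (rearr \<mu> (grad_mod f)) * ennreal (t / J t)"
proof (rule ennreal_le_of_scaled_le)
  fix \<theta> :: real assume \<theta>: "1 < \<theta>"
  let ?R = "op_norm \<rho> hardy_Q * bfs_norm \<rho> (rearr \<mu> (grad_mod f))"
  let ?g = "\<lambda>s. (rearr \<mu> f s - rearr \<mu> f t) * indicator {0..<t} s"
  let ?gn = "\<lambda>n s. (rearr \<mu> f s - rearr \<mu> f t) * indicator {t / \<theta> ^ n..<t} s"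
  note [measurable] = rearr_f_meas
  have ind[measurable]: "(indicator {x..<y} :: real \<Rightarrow> real) \<in> borel_measurable leb01" for x y :: real
    by (rule measurable_leb01) auto
  have Jt: "0 < J t" using J_pos t by auto
  have f_dec: "rearr \<mu> f t \<le> rearr \<mu> f s" if "0 < s" "s < t" for s
    using that t by (intro rearr_antimono[OF prob f_meas[OF f]]) auto
  \<comment> \<open>The function \<open>h\<close> depends on \<open>n\<close> and
    \<open>\<theta>\<close>, but its norm is always that of the rearranged gradient, so the bound is
    uniform in \<open>n\<close>.\<close>
  have bound: "bfs_norm \<rho> (?gn n) \<le> ennreal \<theta> * (?R * ennreal (t / J t))" for n
  proof -
    obtain h where h: "h \<in> borel_measurable leb01" "\<And>s. 0 \<le> h s" "rearr leb01 h = rearr \<mu> (grad_mod f)"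
      and osc: "\<And>s. t / \<theta> ^ n \<le> s \<Longrightarrow> s < t \<Longrightarrow> rearr \<mu> f s - rearr \<mu> f t \<le> \<theta> * (t / J t) * hardy_Q h s"
      using oscillation_le_hardy_Q[OF f \<theta> t, of n] by blast
    note hn = norm_eq_of_rearr_eq[OF h]
    have Qm: "hardy_Q h \<in> borel_measurable leb01"
      using Q hn(1) by (auto simp: bounded_on_def bfs_space_def)
    have "bfs_norm \<rho> (?gn n) \<le> bfs_norm \<rho> (\<lambda>s. \<theta> * (t / J t) * hardy_Q h s)"
    proof (rule bfs_norm_mono[OF bfn])
      show "(\<lambda>s. \<theta> * (t / J t) * hardy_Q h s) \<in> borel_measurable leb01" using Qm by measurable
      fix s :: real assume s: "0 < s" "s < 1"
      show "\<bar>?gn n s\<bar> \<le> \<bar>\<theta> * (t / J t) * hardy_Q h s\<bar>"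
      proof (cases "s \<in> {t / \<theta> ^ n..<t}")
        case True
        then have "\<bar>?gn n s\<bar> = rearr \<mu> f s - rearr \<mu> f t" using f_dec[of s] s by simp
        also have "\<dots> \<le> \<theta> * (t / J t) * hardy_Q h s" using osc[of s] True by simp
        finally show ?thesis by linarith
      qed simp
    qed measurable
    also have "\<dots> = ennreal (\<theta> * (t / J t)) * bfs_norm \<rho> (hardy_Q h)"
      using \<theta> t Jt by (intro bfs_norm_mult[OF bfn Qm]) simp
    also have "\<dots> \<le> ennreal (\<theta> * (t / J t)) * ?R"
      using op_norm_bound[OF bfn Q hardy_Q_scale hn(1)] by (intro mult_left_mono) (simp_all add: hn(2))
    also have "\<dots> = ennreal \<theta> * (?R * ennreal (t / J t))"
      using \<theta> t Jt by (subst ennreal_mult) (auto simp: ac_simps)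
    finally show ?thesis .
  qed
  \<comment> \<open>The cut-offs exhaust \<open>(0,t)\<close> as \<open>n\<close> grows, and the
    Fatou property passes to the limit; the point 0 lies outside \<open>leb01\<close>.\<close>
  have "bfs_norm \<rho> ?g = (SUP n. bfs_norm \<rho> (?gn n))"
    unfolding bfs_norm_def
  proof (rule bfn_SUP[OF bfn])
    show "AE s in leb01. incseq (\<lambda>n. ennreal \<bar>?gn n s\<bar>) \<and> ennreal \<bar>?g s\<bar> = (SUP n. ennreal \<bar>?gn n s\<bar>)"
    proof (rule AE_I2, rule conjI)
      fix s assume "s \<in> space leb01"
      then have s: "0 < s" "s < 1" by auto
      have dec: "t / \<theta> ^ Suc n \<le> t / \<theta> ^ n" for n
        using \<theta> t by (intro divide_left_mono) auto
      show "incseq (\<lambda>n. ennreal \<bar>?gn n s\<bar>)"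
        using dec by (intro incseq_SucI ennreal_leI) (auto split: split_indicator intro: order_trans)
      have "(\<lambda>n. t / \<theta> ^ n) \<longlonglongrightarrow> 0"
        using \<theta> by (intro LIMSEQ_divide_realpow_zero) 
      then have "eventually (\<lambda>n. t / \<theta> ^ n < s) sequentially"
        using s by (intro order_tendstoD) auto
      then obtain N where N: "t / \<theta> ^ N < s" by (auto dest: eventually_happens)
      show "ennreal \<bar>?g s\<bar> = (SUP n. ennreal \<bar>?gn n s\<bar>)"
      proof (rule antisym)
        show "ennreal \<bar>?g s\<bar> \<le> (SUP n. ennreal \<bar>?gn n s\<bar>)"
          using N s by (intro SUP_upper2[of N]) (auto split: split_indicator)
        show "(SUP n. ennreal \<bar>?gn n s\<bar>) \<le> ennreal \<bar>?g s\<bar>"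
          using s by (intro SUP_least ennreal_leI) (auto split: split_indicator)
      qed
    qed
  qed measurable
  also have "\<dots> \<le> ennreal \<theta> * (?R * ennreal (t / J t))"
    by (intro SUP_least bound)
  finally show "bfs_norm \<rho> ?g \<le> ennreal \<theta> * (?R * ennreal (t / J t))" .
qed

text \<open>Pointwise domination on \<open>(0,t)\<close>: the factor \<open>s / J s\<close>
  increases, so it is at most \<open>t / J t\<close>, and the operator norm is applied to the
  rearranged gradient.\<close>

lemma norm_excess_P_le:
  assumes P: "bounded_on \<rho> hardy_P" and t: "0 < t" "t < 1/2"
  shows "bfs_norm \<rho> (\<lambda>s. (rearr_avg \<mu> f s - rearr \<mu> f s) * indicator {0..<t} s)
    \<le> op_norm \<rho> hardy_P * bfs_norm \<rho> (rearr \<mu> (grad_mod f)) * ennreal (t / J t)"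
proof -
  let ?w = "rearr \<mu> (grad_mod f)"
  let ?g = "\<lambda>s. (rearr_avg \<mu> f s - rearr \<mu> f s) * indicator {0..<t} s"
  have Jt: "0 < J t" using J_pos t by auto
  have Pm: "hardy_P ?w \<in> borel_measurable leb01"
    using P rearr_grad_in_space by (auto simp: bounded_on_def bfs_space_def)
  have P0: "0 \<le> hardy_P ?w s" if "0 < s" "s < t" for s
  proof -
    obtain L where L: "\<And>s. 0 < s \<Longrightarrow> s < 1 \<Longrightarrow> 0 \<le> ?w s \<and> ?w s \<le> L"
      using rearr_grad_bounds[OF f] by metis
    show ?thesis
      unfolding hardy_P_def set_lebesgue_integral_def
      using that t L by (intro mult_nonneg_nonneg Bochner_Integration.integral_nonneg) (auto split: split_indicator)
  qed
  have gm: "?g \<in> borel_measurable leb01"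
  proof -
    have [measurable]: "rearr_avg \<mu> f \<in> borel_measurable leb01"
      unfolding rearr_avg_def by (rule borel_measurable_hardy_P_rearr[OF prob f_meas[OF f]])
    have [measurable]: "(indicator {0..<t} :: real \<Rightarrow> real) \<in> borel_measurable leb01"
      by (rule measurable_leb01) auto
    note rearr_f_meas[measurable]
    show ?thesis by measurable
  qed
  have "bfs_norm \<rho> ?g \<le> bfs_norm \<rho> (\<lambda>s. t / J t * hardy_P ?w s)"
  proof (rule bfs_norm_mono[OF bfn gm])
    show "(\<lambda>s. t / J t * hardy_P ?w s) \<in> borel_measurable leb01" using Pm by measurable
    fix s :: real assume s: "0 < s" "s < 1"
    show "\<bar>?g s\<bar> \<le> \<bar>t / J t * hardy_P ?w s\<bar>"
    proof (cases "s < t")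
      case True
      then have "\<bar>?g s\<bar> = rearr_avg \<mu> f s - rearr \<mu> f s"
        using rearr_avg_excess_le(1)[OF f s(1)] s t by simp
      also have "\<dots> \<le> s / J s * hardy_P ?w s"
        using rearr_avg_excess_le(2)[OF f s(1)] True t by simp
      also have "\<dots> \<le> t / J t * hardy_P ?w s"
        using ratio_mono[of s t] P0[OF s(1) True] s True t by (intro mult_right_mono) auto
      finally show ?thesis by linarith
    qed simp
  qed
  also have "\<dots> = ennreal (t / J t) * bfs_norm \<rho> (hardy_P ?w)"
    using t Jt by (intro bfs_norm_mult[OF bfn Pm]) simp
  also have "\<dots> \<le> ennreal (t / J t) * (op_norm \<rho> hardy_P * bfs_norm \<rho> ?w)"
    by (intro mult_left_mono op_norm_bound[OF bfn P hardy_P_scale rearr_grad_in_space]) simp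
  finally show ?thesis by (simp add: mult.commute)
qed

end

text \<open>Monotonicity of the nonnegative integral holds for arbitrary \<open>N\<close>, so
  measurability of the norm in \<open>t\<close> does not have to be shown; measurability enters on
  the right, where \<open>R\<close> is taken out of the integral. Positivity of \<open>J\<close>
  reconciles real division with that of \<open>ennreal\<close>.\<close>

lemma nn_integral_weight_le:
  assumes G: "G \<in> borel_measurable (lebesgue_on {0<..<1/2})"
    and le: "\<And>t. 0 < t \<Longrightarrow> t < 1/2 \<Longrightarrow> N t \<le> R * ennreal (t / J t)"
  shows "(\<integral>\<^sup>+t. N t * ennreal (G t) \<partial>lebesgue_on {0<..<1/2}) \<le> R * weight_integral J G"
proof -
  let ?L = "lebesgue_on {0<..<1/2::real}"
  obtain \<phi> where "profile_shape \<phi>" "\<And>t. t \<in> {0..1/2} \<Longrightarrow> J t = \<phi> t"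
    using est unfolding isop_estimator_def by force
  then have "continuous_on {0<..<1/2} J"
    by (subst continuous_on_cong[OF refl, of _ J \<phi>])
      (auto simp: profile_shape_def intro: continuous_on_subset)
  then have [measurable]: "J \<in> borel_measurable ?L"
    by (intro continuous_imp_measurable_on_sets_lebesgue) auto
  have [measurable]: "(\<lambda>t. t) \<in> borel_measurable ?L"
    by (intro continuous_imp_measurable_on_sets_lebesgue) auto
  note G[measurable]
  have "(\<integral>\<^sup>+t. N t * ennreal (G t) \<partial>?L) \<le> (\<integral>\<^sup>+t. R * (ennreal t / ennreal (J t) * ennreal (G t)) \<partial>?L)"
  proof (intro nn_integral_mono)
    fix t assume "t \<in> space ?L"
    then have t: "0 < t" "t < 1/2" by auto
    have "N t * ennreal (G t) \<le> R * ennreal (t / J t) * ennreal (G t)"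
      using le[OF t] by (intro mult_right_mono) auto
    then show "N t * ennreal (G t) \<le> R * (ennreal t / ennreal (J t) * ennreal (G t))"
      using t J_pos[OF t] by (simp add: divide_ennreal mult.assoc)
  qed
  also have "\<dots> = R * weight_integral J G"
    unfolding weight_integral_def by (intro nn_integral_cmult) measurable
  finally show ?thesis .
qed

end

theorem theorem2:
  fixes \<mu> :: "'a::metric_space measure"
    and J G :: "real \<Rightarrow> real"
    and \<rho> :: "(real \<Rightarrow> ennreal) \<Rightarrow> ennreal"
  assumes "isop_space \<mu>"
    and "isop_estimator \<mu> J"
    and "ri_norm \<rho>"
    and "G \<in> borel_measurable (lebesgue_on {0<..<1/2})"
    and "\<forall>t\<in>{0<..<1/2}. 0 < G t"
    and "weight_integral J G < \<infinity>"
  shows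
    "(bounded_on \<rho> hardy_Q \<longrightarrow>
       (\<forall>f\<in>Lip.
          (\<integral>\<^sup>+t. bfs_norm \<rho> (\<lambda>s. (rearr \<mu> f s - rearr \<mu> f t) * indicator {0..<t} s)
                 * ennreal (G t) \<partial>lebesgue_on {0<..<1/2})
          \<le> op_norm \<rho> hardy_Q * bfs_norm \<rho> (rearr \<mu> (grad_mod f)) * weight_integral J G)) \<and>
     (bounded_on \<rho> hardy_P \<longrightarrow>
       (\<forall>f\<in>Lip.
          (\<integral>\<^sup>+t. bfs_norm \<rho> (\<lambda>s. (rearr_avg \<mu> f s - rearr \<mu> f s) * indicator {0..<t} s)
                 * ennreal (G t) \<partial>lebesgue_on {0<..<1/2})
          \<le> op_norm \<rho> hardy_P * bfs_norm \<rho> (rearr \<mu> (grad_mod f)) * weight_integral J G))"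
proof -
  interpret estimator \<mu> J
  proof (rule estimator.intro)
    show "prob_space \<mu>" "sets \<mu> = sets borel"
      using assms(1) unfolding isop_space_def by blast+
  qed (fact assms(2), rule isop_estimator_pos[OF assms(2,5,6)])
  show ?thesis
  proof (intro conjI impI ballI, goal_cases)
    case (1 f)
    show ?case
      by (rule nn_integral_weight_le[OF assms(4)]) (rule norm_osc_Q_le[OF 1(2) assms(3) 1(1)])
  next
    case (2 f)
    show ?case
      by (rule nn_integral_weight_le[OF assms(4)]) (rule norm_excess_P_le[OF 2(2) assms(3) 2(1)])
  qed
qed

end
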